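(* Every Lie group $G\in\mathcal{G}_1$ admits left invariant Randers metrics of Douglas type that are not of Berwald type.
   Context: $\mathcal{G}_1$ is the family of non-commutative Lie groups $G$ with Lie algebra $\mathfrak{g}$ such that for any $x,y\in\mathfrak{g}$ the bracket $[x,y]$ is a linear combination of $x$ and $y$. It is known (Milnor) that for $G\in\mathcal{G}_1$ there exist a commutative ideal $\mathfrak{u}$ of codimension one and an element $b\in\mathfrak{g}$ with $[b,z]=z$ for every $z\in\mathfrak{u}$. A Finsler metric on a manifold $M$ is a function $F:TM\to[0,\infty)$, smooth on $TM\setminus\{0\}$, positively homogeneous of degree one in $y$, with $(g_{ij})=\left(\frac12\frac{\partial^2F^2}{\partial y^i\partial y^j}\right)$ positive definite on $TM\setminus\{0\}$. On a Lie group, $F$ is left invariant if $F(x,y)=F(e,dl_{x^{-1}}y)$. The left invariant Randers metrics considered are $F(x,y)=\sqrt{g(y,y)}+g(X(x),y)$ with $g$ a left invariant Riemannian metric and $X$ a left invariant vector field; this is a Finsler metric if and only if $\sqrt{g(X,X)}<1$. The spray coefficients of $F$ are $G^i=\frac14 g^{il}\left([F^2]_{x^my^l}y^m-[F^2]_{x^l}\right)$, with $(g^{il})$ the inverse of $(g_{ij})$. $F$ is of Douglas type if in any standard local coordinate system of $TM$ one has $G^i=\frac12\Gamma^i_{jk}(x)y^jy^k+P(x,y)y^i$, where $P(x,y)$ is a local positively homogeneous function of degree one in $y$. $F$ is of Berwald type if, in standard local coordinates on $TM\setminus\{0\}$, the Christoffel symbols of its Chern connection do not depend on $y$ (in which case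 the spray coefficients are quadratic in $y$).
   Formalization: "Non-commutative Lie group" is taken to mean that the identity component is non-commutative; for disconnected groups with commutative Lie algebra, such as O(2), the claim is false, since all left invariant Randers metrics are then of Berwald type. *)

theory Defs
  imports "HOL-Analysis.Analysis"
begin

section \<open>Smooth maps between open subsets of normed spaces\<close>

text \<open>\<open>S\<close> is meant to be open; \<open>f\<close> is only inspected on \<open>S\<close>.\<close>

primrec Ck_on :: "nat \<Rightarrow> 'a::real_normed_vector set \<Rightarrow> ('a \<Rightarrow> 'b::real_normed_vector) \<Rightarrow> bool" where
  "Ck_on 0 S f \<longleftrightarrow> continuous_on S f"
| "Ck_on (Suc k) S f \<longleftrightarrow> (\<forall>x\<in>S. f differentiable (at x)) \<and>
      (\<forall>v. Ck_on k S (\<lambda>x. frechet_derivative f (at x) v))"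

definition smooth_on :: "'a::real_normed_vector set \<Rightarrow> ('a \<Rightarrow> 'b::real_normed_vector) \<Rightarrow> bool" where
  "smooth_on S f \<longleftrightarrow> (\<forall>k. Ck_on k S f)"


section \<open>Smooth manifolds\<close>

text \<open>A chart is a pair of a domain and a map; only the values of the map on the domain matter.\<close>

type_synonym ('m, 'e) chart = "'m set \<times> ('m \<Rightarrow> 'e)"

abbreviation cdom :: "('m, 'e) chart \<Rightarrow> 'm set" where "cdom c \<equiv> fst c"
abbreviation cmap :: "('m, 'e) chart \<Rightarrow> 'm \<Rightarrow> 'e" where "cmap c \<equiv> snd c"

definition cinv :: "('m, 'e) chart \<Rightarrow> 'e \<Rightarrow> 'm" where
  "cinv c = inv_into (cdom c) (cmap c)"

abbreviation crange :: "('m, 'e) chart \<Rightarrow> 'e set" where "crange c \<equiv> cmap c ` cdom c"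

definition is_chart :: "('m::topological_space, 'e::euclidean_space) chart \<Rightarrow> bool" where
  "is_chart c \<longleftrightarrow> open (cdom c) \<and> open (crange c) \<and>
     homeomorphism (cdom c) (crange c) (cmap c) (cinv c)"

definition compatible ::
  "('m::topological_space, 'e::euclidean_space) chart \<Rightarrow> ('m, 'e) chart \<Rightarrow> bool" where
  "compatible c d \<longleftrightarrow>
     smooth_on (cmap c ` (cdom c \<inter> cdom d)) (cmap d \<circ> cinv c) \<and>
     smooth_on (cmap d ` (cdom c \<inter> cdom d)) (cmap c \<circ> cinv d)"

text \<open>A smooth structure is a maximal smooth atlas, so that its members are exactly the
  local coordinate systems of the manifold. The Hausdorff property and second countability
  are imposed through type classes, see \<open>lie_group\<close>.\<close>

definition smooth_structure :: "('m::topological_space, 'e::euclidean_space) chart set \<Rightarrow> bool" where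
  "smooth_structure A \<longleftrightarrow>
     (\<forall>c\<in>A. is_chart c) \<and> (\<Union>c\<in>A. cdom c) = UNIV \<and>
     (\<forall>c\<in>A. \<forall>d\<in>A. compatible c d) \<and>
     (\<forall>d. is_chart d \<and> (\<forall>c\<in>A. compatible c d) \<longrightarrow> d \<in> A)"

definition smooth_map ::
  "('m::topological_space, 'e::euclidean_space) chart set \<Rightarrow>
   ('n::topological_space, 'f::euclidean_space) chart set \<Rightarrow> ('m \<Rightarrow> 'n) \<Rightarrow> bool" where
  "smooth_map A B f \<longleftrightarrow> continuous_on UNIV f \<and>
     (\<forall>c\<in>A. \<forall>d\<in>B. smooth_on (cmap c ` (cdom c \<inter> f -` cdom d)) (cmap d \<circ> f \<circ> cinv c))"

text \<open>The product charts form an atlas of the product manifold (not a maximal one, which is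
  immaterial for \<open>smooth_map\<close>).\<close>

definition prod_atlas ::
  "('m, 'e) chart set \<Rightarrow> ('n, 'f) chart set \<Rightarrow> ('m \<times> 'n, 'e \<times> 'f) chart set" where
  "prod_atlas A B = {(cdom c \<times> cdom d, map_prod (cmap c) (cmap d)) | c d. c \<in> A \<and> d \<in> B}"


section \<open>Tangent vectors and vector fields\<close>

text \<open>A tangent vector at \<open>p\<close> is the family of its component vectors in all the charts around
  \<open>p\<close>, subject to the usual transformation rule. The components in the irrelevant charts are
  set to 0, so that equality of tangent vectors is equality of functions and the vector space
  operations are pointwise.\<close>

type_synonym ('m, 'e) tvec = "('m, 'e) chart \<Rightarrow> 'e"

definition tangent_space ::
  "('m::topological_space, 'e::euclidean_space) chart set \<Rightarrow> 'm \<Rightarrow> ('m, 'e) tvec set" where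
  "tangent_space A p = {v.
     (\<forall>c\<in>A. \<forall>d\<in>A. p \<in> cdom c \<longrightarrow> p \<in> cdom d \<longrightarrow>
        v d = frechet_derivative (cmap d \<circ> cinv c) (at (cmap c p)) (v c)) \<and>
     (\<forall>c. \<not> (c \<in> A \<and> p \<in> cdom c) \<longrightarrow> v c = 0)}"

text \<open>The tangent vector at \<open>p\<close> with components \<open>y\<close> in the chart \<open>c\<close>, i.e. \<open>y\<^sup>i \<partial>/\<partial>x\<^sup>i\<close>.\<close>

definition coord_tvec ::
  "('m::topological_space, 'e::euclidean_space) chart set \<Rightarrow> ('m, 'e) chart \<Rightarrow> 'm \<Rightarrow> 'e \<Rightarrow> ('m, 'e) tvec" where
  "coord_tvec A c p y = (\<lambda>d. if d \<in> A \<and> p \<in> cdom d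
      then frechet_derivative (cmap d \<circ> cinv c) (at (cmap c p)) y else 0)"

text \<open>The differential of \<open>f\<close> at \<open>p\<close>; by the chain rule the chart chosen around \<open>p\<close> is immaterial.\<close>

definition differential ::
  "('m::topological_space, 'e::euclidean_space) chart set \<Rightarrow>
   ('n::topological_space, 'f::euclidean_space) chart set \<Rightarrow>
   ('m \<Rightarrow> 'n) \<Rightarrow> 'm \<Rightarrow> ('m, 'e) tvec \<Rightarrow> ('n, 'f) tvec" where
  "differential A B f p v = (\<lambda>d. if d \<in> B \<and> f p \<in> cdom d
      then (let c = (SOME c. c \<in> A \<and> p \<in> cdom c)
            in frechet_derivative (cmap d \<circ> f \<circ> cinv c) (at (cmap c p)) (v c))
      else 0)"

definition vector_field ::
  "('m::topological_space, 'e::euclidean_space) chart set \<Rightarrow> ('m \<Rightarrow> ('m, 'e) tvec) \<Rightarrow> bool" where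
  "vector_field A X \<longleftrightarrow> (\<forall>p. X p \<in> tangent_space A p) \<and>
     (\<forall>c\<in>A. smooth_on (crange c) (\<lambda>x. X (cinv c x) c))"

text \<open>\<open>[X,Y]\<^sup>i = X\<^sup>j \<partial>\<^sub>j Y\<^sup>i - Y\<^sup>j \<partial>\<^sub>j X\<^sup>i\<close> in every chart.\<close>

definition lie_bracket ::
  "('m::topological_space, 'e::euclidean_space) chart set \<Rightarrow> ('m \<Rightarrow> ('m, 'e) tvec) \<Rightarrow>
   ('m \<Rightarrow> ('m, 'e) tvec) \<Rightarrow> 'm \<Rightarrow> ('m, 'e) tvec" where
  "lie_bracket A X Y p = (\<lambda>c. if c \<in> A \<and> p \<in> cdom c
      then frechet_derivative (\<lambda>x. Y (cinv c x) c) (at (cmap c p)) (X p c) -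
           frechet_derivative (\<lambda>x. X (cinv c x) c) (at (cmap c p)) (Y p c)
      else 0)"


section \<open>Lie groups and the family \<open>\<G>\<^sub>1\<close>\<close>

locale lie_group = group mul e inve
  for mul :: "'g::{t2_space, second_countable_topology} \<Rightarrow> 'g \<Rightarrow> 'g" and e :: 'g
    and inve :: "'g \<Rightarrow> 'g" +
  fixes A :: "('g, 'e::euclidean_space) chart set"
  assumes smooth_structure: "smooth_structure A"
    and smooth_mult: "smooth_map (prod_atlas A A) A (\<lambda>(x, y). mul x y)"
    and smooth_inv: "smooth_map A A inve"

definition lie_algebra ::
  "('g::topological_space \<Rightarrow> 'g \<Rightarrow> 'g) \<Rightarrow> ('g, 'e::euclidean_space) chart set \<Rightarrow>
   ('g \<Rightarrow> ('g, 'e) tvec) set" where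
  "lie_algebra mul A = {X. vector_field A X \<and>
     (\<forall>x p. X (mul x p) = differential A A (mul x) p (X p))}"

text \<open>Non-commutativity is required of the identity component. For connected \<open>G\<close> this is
  non-commutativity of \<open>G\<close> itself. For disconnected \<open>G\<close> the latter would not be enough: a
  non-commutative semidirect product of a torus and a finite group has a commutative Lie algebra, hence
  satisfies the bracket condition, but has no element \<open>b\<close> acting as the identity on an ideal
  of codimension one, and its left invariant Randers metrics are all of Berwald type.\<close>

definition family_G1 ::
  "('g::{t2_space, second_countable_topology} \<Rightarrow> 'g \<Rightarrow> 'g) \<Rightarrow> 'g \<Rightarrow> ('g \<Rightarrow> 'g) \<Rightarrow>
   ('g, 'e::euclidean_space) chart set \<Rightarrow> bool" where
  "family_G1 mul e inve A \<longleftrightarrow> lie_group mul e inve A \<and>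
     (\<exists>x \<in> connected_component_set UNIV e. \<exists>y \<in> connected_component_set UNIV e.
        mul x y \<noteq> mul y x) \<and>
     (\<forall>X \<in> lie_algebra mul A. \<forall>Y \<in> lie_algebra mul A. \<exists>a b :: real.
        lie_bracket A X Y = (\<lambda>p c. a *\<^sub>R X p c + b *\<^sub>R Y p c))"


section \<open>Finsler metrics in standard local coordinates\<close>

text \<open>In the sequel \<open>f x y\<close> is a function on an open subset of \<open>TM\<close> in standard local
  coordinates \<open>(x\<^sup>i, y\<^sup>i)\<close>.\<close>

definition dx :: "'n \<Rightarrow> (real^'n \<Rightarrow> real^'n \<Rightarrow> real) \<Rightarrow> real^'n \<Rightarrow> real^'n \<Rightarrow> real" where
  "dx i f x y = frechet_derivative (\<lambda>x'. f x' y) (at x) (axis i 1)"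

definition dy :: "'n \<Rightarrow> (real^'n \<Rightarrow> real^'n \<Rightarrow> real) \<Rightarrow> real^'n \<Rightarrow> real^'n \<Rightarrow> real" where
  "dy i f x y = frechet_derivative (f x) (at y) (axis i 1)"

definition local_rep ::
  "('m::topological_space, 'e::euclidean_space) chart set \<Rightarrow> ('m, 'e) chart \<Rightarrow>
   ('m \<Rightarrow> ('m, 'e) tvec \<Rightarrow> real) \<Rightarrow> 'e \<Rightarrow> 'e \<Rightarrow> real" where
  "local_rep A c F x y = F (cinv c x) (coord_tvec A c (cinv c x) y)"

definition fundamental_tensor ::
  "(real^'n \<Rightarrow> real^'n \<Rightarrow> real) \<Rightarrow> real^'n \<Rightarrow> real^'n \<Rightarrow> real^'n^'n" where
  "fundamental_tensor f x y = (\<chi> i j. 1/2 * dy i (dy j (\<lambda>x y. (f x y)\<^sup>2)) x y)"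

text \<open>A metric is a function \<open>F p v\<close> of which only the values at \<open>v \<in> tangent_space A p\<close> matter.\<close>

definition finsler_metric ::
  "('m::topological_space, real^'n) chart set \<Rightarrow> ('m \<Rightarrow> ('m, real^'n) tvec \<Rightarrow> real) \<Rightarrow> bool" where
  "finsler_metric A F \<longleftrightarrow>
     (\<forall>p. \<forall>v \<in> tangent_space A p. 0 \<le> F p v) \<and>
     (\<forall>c\<in>A. smooth_on (crange c \<times> (- {0})) (\<lambda>(x, y). local_rep A c F x y)) \<and>
     (\<forall>p. \<forall>v \<in> tangent_space A p. \<forall>t>0. F p (\<lambda>c. t *\<^sub>R v c) = t * F p v) \<and>
     (\<forall>c\<in>A. \<forall>x \<in> crange c. \<forall>y. y \<noteq> 0 \<longrightarrow>
        (\<forall>w. w \<noteq> 0 \<longrightarrow> 0 < w \<bullet> (fundamental_tensor (local_rep A c F) x y *v w)))"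

definition spray_coeff ::
  "(real^'n \<Rightarrow> real^'n \<Rightarrow> real) \<Rightarrow> 'n \<Rightarrow> real^'n \<Rightarrow> real^'n \<Rightarrow> real" where
  "spray_coeff f i x y =
     1/4 * (\<Sum>l\<in>UNIV. matrix_inv (fundamental_tensor f x y) $ i $ l *
       ((\<Sum>m\<in>UNIV. dx m (dy l (\<lambda>x y. (f x y)\<^sup>2)) x y * y $ m) - dx l (\<lambda>x y. (f x y)\<^sup>2) x y))"

definition douglas_type ::
  "('m::topological_space, real^'n) chart set \<Rightarrow> ('m \<Rightarrow> ('m, real^'n) tvec \<Rightarrow> real) \<Rightarrow> bool" where
  "douglas_type A F \<longleftrightarrow> (\<forall>c\<in>A.
     \<exists>(\<Gamma> :: 'n \<Rightarrow> 'n \<Rightarrow> 'n \<Rightarrow> real^'n \<Rightarrow> real) (P :: real^'n \<Rightarrow> real^'n \<Rightarrow> real).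
       (\<forall>x \<in> crange c. \<forall>y. y \<noteq> 0 \<longrightarrow> (\<forall>t>0. P x (t *\<^sub>R y) = t * P x y)) \<and>
       (\<forall>x \<in> crange c. \<forall>y. y \<noteq> 0 \<longrightarrow> (\<forall>i. spray_coeff (local_rep A c F) i x y =
          1/2 * (\<Sum>j\<in>UNIV. \<Sum>k\<in>UNIV. \<Gamma> i j k x * y $ j * y $ k) + P x y * y $ i)))"

text \<open>The nonlinear connection \<open>N\<^sup>i\<^sub>j = \<partial>G\<^sup>i/\<partial>y\<^sup>j\<close> (geodesics satisfy \<open>x'' + 2 G(x,x') = 0\<close> with
  the above normalization of \<open>G\<^sup>i\<close>), and the horizontal derivative
  \<open>\<delta>/\<delta>x\<^sup>k = \<partial>/\<partial>x\<^sup>k - N\<^sup>m\<^sub>k \<partial>/\<partial>y\<^sup>m\<close>.\<close>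

definition nonlinear_conn ::
  "(real^'n \<Rightarrow> real^'n \<Rightarrow> real) \<Rightarrow> 'n \<Rightarrow> 'n \<Rightarrow> real^'n \<Rightarrow> real^'n \<Rightarrow> real" where
  "nonlinear_conn f i j = dy j (spray_coeff f i)"

definition horizontal_deriv ::
  "(real^'n \<Rightarrow> real^'n \<Rightarrow> real) \<Rightarrow> 'n \<Rightarrow> (real^'n \<Rightarrow> real^'n \<Rightarrow> real) \<Rightarrow>
   real^'n \<Rightarrow> real^'n \<Rightarrow> real" where
  "horizontal_deriv f k h x y = dx k h x y - (\<Sum>m\<in>UNIV. nonlinear_conn f m k x y * dy m h x y)"

text \<open>The Christoffel symbols
  \<open>\<Gamma>\<^sup>i\<^sub>j\<^sub>k = 1/2 g\<^sup>i\<^sup>l (\<delta>g\<^sub>l\<^sub>j/\<delta>x\<^sup>k + \<delta>g\<^sub>l\<^sub>k/\<delta>x\<^sup>j - \<delta>g\<^sub>j\<^sub>k/\<delta>x\<^sup>l)\<close> of the Chern connection.\<close>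

definition chern_christoffel ::
  "(real^'n \<Rightarrow> real^'n \<Rightarrow> real) \<Rightarrow> 'n \<Rightarrow> 'n \<Rightarrow> 'n \<Rightarrow> real^'n \<Rightarrow> real^'n \<Rightarrow> real" where
  "chern_christoffel f i j k x y =
     (let g = (\<lambda>a b x y. fundamental_tensor f x y $ a $ b) in
      1/2 * (\<Sum>l\<in>UNIV. matrix_inv (fundamental_tensor f x y) $ i $ l *
        (horizontal_deriv f k (g l j) x y + horizontal_deriv f j (g l k) x y
         - horizontal_deriv f l (g j k) x y)))"

definition berwald_type ::
  "('m::topological_space, real^'n) chart set \<Rightarrow> ('m \<Rightarrow> ('m, real^'n) tvec \<Rightarrow> real) \<Rightarrow> bool" where
  "berwald_type A F \<longleftrightarrow> (\<forall>c\<in>A. \<forall>x \<in> crange c. \<forall>y z. y \<noteq> 0 \<longrightarrow> z \<noteq> 0 \<longrightarrow>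
     (\<forall>i j k. chern_christoffel (local_rep A c F) i j k x y =
              chern_christoffel (local_rep A c F) i j k x z))"


section \<open>Left invariant Randers metrics\<close>

definition riemannian_metric ::
  "('m::topological_space, 'e::euclidean_space) chart set \<Rightarrow>
   ('m \<Rightarrow> ('m, 'e) tvec \<Rightarrow> ('m, 'e) tvec \<Rightarrow> real) \<Rightarrow> bool" where
  "riemannian_metric A g \<longleftrightarrow>
     (\<forall>p. \<forall>u \<in> tangent_space A p. \<forall>v \<in> tangent_space A p. g p u v = g p v u) \<and>
     (\<forall>p. \<forall>u \<in> tangent_space A p. \<forall>v \<in> tangent_space A p. \<forall>w \<in> tangent_space A p. \<forall>a b.
        g p (\<lambda>c. a *\<^sub>R u c + b *\<^sub>R v c) w = a * g p u w + b * g p v w) \<and>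
     (\<forall>p. \<forall>u \<in> tangent_space A p. u \<noteq> (\<lambda>c. 0) \<longrightarrow> 0 < g p u u) \<and>
     (\<forall>c\<in>A. \<forall>u v. smooth_on (crange c)
        (\<lambda>x. g (cinv c x) (coord_tvec A c (cinv c x) u) (coord_tvec A c (cinv c x) v)))"

definition left_invariant_riemannian ::
  "('g::topological_space \<Rightarrow> 'g \<Rightarrow> 'g) \<Rightarrow> ('g, 'e::euclidean_space) chart set \<Rightarrow>
   ('g \<Rightarrow> ('g, 'e) tvec \<Rightarrow> ('g, 'e) tvec \<Rightarrow> real) \<Rightarrow> bool" where
  "left_invariant_riemannian mul A g \<longleftrightarrow> riemannian_metric A g \<and>
     (\<forall>x p. \<forall>u \<in> tangent_space A p. \<forall>v \<in> tangent_space A p.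
        g (mul x p) (differential A A (mul x) p u) (differential A A (mul x) p v) = g p u v)"

definition left_invariant_finsler ::
  "('g::topological_space \<Rightarrow> 'g \<Rightarrow> 'g) \<Rightarrow> 'g \<Rightarrow> ('g \<Rightarrow> 'g) \<Rightarrow> ('g, real^'n) chart set \<Rightarrow>
   ('g \<Rightarrow> ('g, real^'n) tvec \<Rightarrow> real) \<Rightarrow> bool" where
  "left_invariant_finsler mul e inve A F \<longleftrightarrow> finsler_metric A F \<and>
     (\<forall>x. \<forall>y \<in> tangent_space A x. F x y = F e (differential A A (mul (inve x)) x y))"

definition left_invariant_randers ::
  "('g::topological_space \<Rightarrow> 'g \<Rightarrow> 'g) \<Rightarrow> 'g \<Rightarrow> ('g \<Rightarrow> 'g) \<Rightarrow> ('g, real^'n) chart set \<Rightarrow>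
   ('g \<Rightarrow> ('g, real^'n) tvec \<Rightarrow> real) \<Rightarrow> bool" where
  "left_invariant_randers mul e inve A F \<longleftrightarrow> left_invariant_finsler mul e inve A F \<and>
     (\<exists>g X. left_invariant_riemannian mul A g \<and> X \<in> lie_algebra mul A \<and>
        (\<forall>x. sqrt (g x (X x) (X x)) < 1) \<and>
        (\<forall>x. \<forall>y \<in> tangent_space A x. F x y = sqrt (g x y y) + g x (X x) y))"

end

(* Translating tangent vectors to e identifies each tangent space with R^n, and a bracket with
   [v,w] in span{v,w} has the form [v,w] = (mu.v) w - (mu.w) v. Take the metric F(y) = |v| + k mu.v,
   where v is the translate of y and 0 < k < 1/|mu|. Since v is expressed by forms satisfying the
   Maurer-Cartan equation, the equation for the spray becomes an identity in the fixed Minkowski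
   space R^n, with the solution G = (quadratic in y) + P y and
   P = - k (|mu|^2 |v|^2 - (mu.v)^2) / (2F); so F is of Douglas type. The Chern symbols satisfy
   Gamma_jk y^j y^k = 2 G. If they did not depend on y, then G would be even, hence
   P(y) + P(-y) = 0, but both terms are negative if v is orthogonal to mu.
   Such a v exists unless the bracket vanishes. In that case the left invariant coframe is closed,
   so it is locally d phi, and phi is an injective local homomorphism to R^n. Therefore a
   neighbourhood of e, and with it the identity component, is commutative. *)
theory Submission
  imports Defs
begin

section \<open>Calculus of smooth maps\<close>

text \<open>The vector \<open>\<mu>\<close> carries Milnor's structure: its orthogonal complement is
  the commutative ideal, and \<open>\<mu>\<close> divided by |\<mu>|^2 acts on it as the identity.
  Since \<open>\<mu>\<close> is orthogonal to every bracket, the left invariant one-form with value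
  k \<mu> is closed, so adding it to the Riemannian length does not change the unparametrised
  geodesics. This predicts both parts of the spray: the quadratic part is the Riemannian spray, and
  P is the covariant derivative of the one-form evaluated at (v, v), divided by 2F. Strictness in
  the Cauchy-Schwarz inequality says that this derivative is not zero off the line of
  \<open>\<mu>\<close>, which is what rules out Berwald type. The obstacle is that sprays and Chern
  symbols are iterated partial derivatives of F^2 in arbitrary charts. The derivatives are therefore
  computed once for a fixed norm on R^n and carried to a chart by the chain rule. The predicted
  spray is then inserted into the linear system whose matrix is the fundamental tensor, so that no
  explicit inverse of that tensor is ever computed.\<close>

lemma Ck_on_subset: "Ck_on k S f \<Longrightarrow> T \<subseteq> S \<Longrightarrow> Ck_on k T f"
  by (induction k arbitrary: f) (auto intro: continuous_on_subset)

lemma Ck_on_imp_continuous_on: "Ck_on k S f \<Longrightarrow> continuous_on S f"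
  by (cases k) (auto intro!: continuous_at_imp_continuous_on differentiable_imp_continuous_within)

lemma Ck_on_Suc_imp: "Ck_on (Suc k) S f \<Longrightarrow> Ck_on k S f"
proof (induction k arbitrary: f)
  case 0
  then show ?case using Ck_on_imp_continuous_on[OF 0] by simp
next
  case (Suc k)
  have "Ck_on k S (\<lambda>x. frechet_derivative f (at x) v)" for v
    by (rule Suc.IH) (use Suc.prems in simp)
  then show ?case using Suc.prems by simp
qed

text \<open>On an open set the derivative at a point depends only on nearby values, so agreement on
  \<open>S\<close> passes to all derivatives. This is needed throughout because chart maps are
  arbitrary outside their domains.\<close>

lemma Ck_on_cong:
  assumes "open S" "\<And>x. x \<in> S \<Longrightarrow> f x = g x" "Ck_on k S f"
  shows "Ck_on k S g"
  using assms(2,3)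
proof (induction k arbitrary: f g)
  case 0
  then show ?case by (simp cong: continuous_on_cong)
next
  case (Suc k)
  have "(g has_derivative frechet_derivative f (at x)) (at x)" if "x \<in> S" for x
    by (rule has_derivative_transform_within_open[OF _ assms(1) that, of f])
      (use Suc.prems that in \<open>auto simp: frechet_derivative_works\<close>)
  then have *: "g differentiable (at x)" "frechet_derivative f (at x) = frechet_derivative g (at x)"
    if "x \<in> S" for x
    using that by (auto simp: differentiable_def dest: frechet_derivative_at)
  have "Ck_on k S (\<lambda>x. frechet_derivative g (at x) v)" for v
    by (rule Suc.IH[of "\<lambda>x. frechet_derivative f (at x) v"]) (use * Suc.prems in auto)
  with * show ?case by auto
qed

text \<open>Replaces \<open>frechet_derivative\<close> by any explicit derivative; the inductions
  for sums, products, composites, \<open>inverse\<close> and \<open>sqrt\<close> rest on it.\<close>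

lemma Ck_on_SucI:
  assumes "open S" "\<And>x. x \<in> S \<Longrightarrow> (f has_derivative f' x) (at x)" "\<And>v. Ck_on k S (\<lambda>x. f' x v)"
  shows "Ck_on (Suc k) S f"
proof -
  have "frechet_derivative f (at x) = f' x" if "x \<in> S" for x
    using frechet_derivative_at[OF assms(2)[OF that]] by simp
  then have "Ck_on k S (\<lambda>x. frechet_derivative f (at x) v)" for v
    using Ck_on_cong[OF assms(1) _ assms(3)] by auto
  then show ?thesis using assms(2) by (auto simp: differentiable_def)
qed

lemma Ck_on_SucD:
  assumes "Ck_on (Suc k) S f" "x \<in> S"
  shows "(f has_derivative frechet_derivative f (at x)) (at x)"
  using assms by (auto simp: frechet_derivative_works)

lemma Ck_on_const: "Ck_on k S (\<lambda>x. c)"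
  by (induction k arbitrary: c) auto

lemma Ck_on_bounded_linear: "bounded_linear f \<Longrightarrow> Ck_on k S f"
proof (induction k)
  case (Suc k)
  then have "frechet_derivative f (at x) = f" for x
    using frechet_derivative_at[OF bounded_linear_imp_has_derivative] by metis
  then show ?case using Suc.prems
    by (auto simp: Ck_on_const bounded_linear_imp_differentiable)
qed (simp add: linear_continuous_on)

lemma Ck_on_add:
  assumes "open S"
  shows "Ck_on k S f \<Longrightarrow> Ck_on k S g \<Longrightarrow> Ck_on k S (\<lambda>x. f x + g x)"
proof (induction k arbitrary: f g)
  case (Suc k)
  show ?case
    by (rule Ck_on_SucI[OF assms, OF has_derivative_add])
       (use Suc in \<open>auto simp: frechet_derivative_works\<close>)
qed (simp add: continuous_on_add)

lemma Ck_on_bounded_bilinear: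
  assumes "bounded_bilinear B" "open S"
  shows "Ck_on k S f \<Longrightarrow> Ck_on k S g \<Longrightarrow> Ck_on k S (\<lambda>x. B (f x) (g x))"
proof (induction k arbitrary: f g)
  case 0
  then show ?case by (simp add: bounded_bilinear.continuous_on[OF assms(1)])
next
  case (Suc k)
  have "Ck_on k S f" "Ck_on k S g" using Suc.prems Ck_on_Suc_imp by blast+
  with Suc show ?case
    by (intro Ck_on_SucI[OF assms(2) bounded_bilinear.FDERIV[OF assms(1)]])
       (auto simp: frechet_derivative_works intro!: Ck_on_add[OF assms(2)])
qed

lemma Ck_on_sum:
  assumes "open S" "\<And>i. i \<in> I \<Longrightarrow> Ck_on k S (f i)"
  shows "Ck_on k S (\<lambda>x. \<Sum>i\<in>I. f i x)"
  using assms(2)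
  by (induction I rule: infinite_finite_induct) (auto intro: Ck_on_const Ck_on_add[OF assms(1)])

lemma linear_Basis_expansion:
  fixes f :: "'a::euclidean_space \<Rightarrow> 'b::real_vector"
  assumes "linear f"
  shows "f w = (\<Sum>b\<in>Basis. (w \<bullet> b) *\<^sub>R f b)"
proof -
  have "f w = f (\<Sum>b\<in>Basis. (w \<bullet> b) *\<^sub>R b)" by (simp add: euclidean_representation)
  also have "\<dots> = (\<Sum>b\<in>Basis. (w \<bullet> b) *\<^sub>R f b)"
    by (simp add: linear_sum[OF assms] linear_cmul[OF assms])
  finally show ?thesis .
qed

text \<open>In the chain rule both the linear map and the vector it is applied to depend on x.
  Expanding the vector in \<open>Basis\<close> separates them into products of a scalar function
  with a composite of a fixed partial derivative of \<open>f\<close> with \<open>g\<close>, to which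
  the induction hypothesis applies.\<close>

lemma Ck_on_compose:
  fixes g :: "'a::real_normed_vector \<Rightarrow> 'b::euclidean_space" and f :: "'b \<Rightarrow> 'c::real_normed_vector"
  assumes "open S" "open T" "\<And>x. x \<in> S \<Longrightarrow> g x \<in> T"
  shows "Ck_on k T f \<Longrightarrow> Ck_on k S g \<Longrightarrow> Ck_on k S (\<lambda>x. f (g x))"
proof (induction k arbitrary: f)
  case 0
  then show ?case using assms continuous_on_compose2[of T f S g] by auto
next
  case (Suc k)
  note gk = Ck_on_Suc_imp[OF Suc.prems(2)]
  have D: "((\<lambda>x. f (g x)) has_derivative
      (\<lambda>v. frechet_derivative f (at (g x)) (frechet_derivative g (at x) v))) (at x)" if "x \<in> S" for x
    using Ck_on_SucD[OF Suc.prems(2) that] Ck_on_SucD[OF Suc.prems(1) assms(3)[OF that]]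
    by (rule has_derivative_compose)
  have E: "frechet_derivative f (at (g x)) w =
      (\<Sum>b\<in>Basis. (w \<bullet> b) *\<^sub>R frechet_derivative f (at (g x)) b)" if "x \<in> S" for x w
  proof -
    have "linear (frechet_derivative f (at (g x)))"
      using Suc.prems(1) assms(3)[OF that] by (simp add: linear_frechet_derivative)
    then show ?thesis by (rule linear_Basis_expansion)
  qed
  have "Ck_on k S (\<lambda>x. \<Sum>b\<in>Basis. (frechet_derivative g (at x) v \<bullet> b) *\<^sub>R
          frechet_derivative f (at (g x)) b)" for v
    using Suc.prems Suc.IH[OF _ gk]
    by (intro Ck_on_sum[OF assms(1)] Ck_on_bounded_bilinear[OF bounded_bilinear_scaleR assms(1)]
          Ck_on_bounded_bilinear[OF bounded_bilinear_inner assms(1)] Ck_on_const) auto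
  then have "Ck_on k S (\<lambda>x. frechet_derivative f (at (g x)) (frechet_derivative g (at x) v))" for v
    by (rule Ck_on_cong[OF assms(1), rotated]) (use E in simp)
  with D show ?case by (intro Ck_on_SucI[OF assms(1)]) auto
qed

text \<open>The derivative is a polynomial in \<open>inverse\<close> itself, so each order follows
  from the previous one.\<close>

lemma Ck_on_inverse: "Ck_on k (- {0}) (inverse :: real \<Rightarrow> real)"
proof (induction k)
  case 0
  show ?case by (auto intro!: continuous_intros)
next
  case (Suc k)
  have "open (- {0::real})" by auto
  have neg: "Ck_on k (- {0}) (\<lambda>x::real. - inverse x)"
    using Ck_on_bounded_bilinear[OF bounded_bilinear_mult \<open>open _\<close> Ck_on_const[of _ _ "-1"] Suc]
    by simp
  show ?case
  proof (rule Ck_on_SucI[OF \<open>open _\<close>])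
    show "(inverse has_derivative (\<lambda>v. - inverse x * v * inverse x)) (at x)"
      if "x \<in> - {0}" for x :: real
      using has_derivative_inverse'[of x UNIV] that by simp
    show "Ck_on k (- {0}) (\<lambda>x::real. - inverse x * v * inverse x)" for v
      using Ck_on_bounded_bilinear[OF bounded_bilinear_mult \<open>open _\<close>
        Ck_on_bounded_bilinear[OF bounded_bilinear_mult \<open>open _\<close> neg Ck_on_const] Suc] .
  qed
qed

lemma Ck_on_sqrt: "Ck_on k {0<..} sqrt"
proof (induction k)
  case 0
  show ?case by (auto intro!: continuous_intros)
next
  case (Suc k)
  have *: "open {0::real<..}" by auto
  show ?case
  proof (rule Ck_on_SucI[OF *, of _ "\<lambda>x v. inverse (sqrt x) * (v / 2)"])
    show "(sqrt has_derivative (\<lambda>v. inverse (sqrt x) * (v / 2))) (at x)" if "x \<in> {0<..}" for x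
    proof -
      have "(\<lambda>v. inverse (sqrt x) * (v / 2)) = (*) (inverse (sqrt x) / 2)"
        by (simp add: fun_eq_iff)
      then show ?thesis using that DERIV_real_sqrt[of x] by (simp add: has_field_derivative_def)
    qed
    have "Ck_on k {0::real<..} (\<lambda>x. inverse (sqrt x))"
      by (rule Ck_on_compose[OF * _ _ Ck_on_inverse Suc]) auto
    then show "Ck_on k {0::real<..} (\<lambda>x. inverse (sqrt x) * (v / 2))" for v
      by (intro Ck_on_bounded_bilinear[OF bounded_bilinear_mult] * Ck_on_const)
  qed
qed

section \<open>Smoothness of all orders\<close>

lemma smooth_on_imp_Ck_on: "smooth_on S f \<Longrightarrow> Ck_on k S f"
  by (simp add: smooth_on_def)

lemma smooth_on_const: "smooth_on S (\<lambda>x. c)"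
  by (simp add: smooth_on_def Ck_on_const)

lemma smooth_on_bounded_linear: "bounded_linear f \<Longrightarrow> smooth_on S f"
  by (simp add: smooth_on_def Ck_on_bounded_linear)

lemma smooth_on_subset: "smooth_on S f \<Longrightarrow> T \<subseteq> S \<Longrightarrow> smooth_on T f"
  using Ck_on_subset unfolding smooth_on_def by blast

lemma smooth_on_cong:
  "smooth_on S f \<Longrightarrow> open S \<Longrightarrow> (\<And>x. x \<in> S \<Longrightarrow> f x = g x) \<Longrightarrow> smooth_on S g"
  using Ck_on_cong unfolding smooth_on_def by blast

lemma smooth_on_bounded_bilinear:
  "bounded_bilinear B \<Longrightarrow> open S \<Longrightarrow> smooth_on S f \<Longrightarrow> smooth_on S g \<Longrightarrow>
    smooth_on S (\<lambda>x. B (f x) (g x))"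
  by (simp add: smooth_on_def Ck_on_bounded_bilinear)

lemmas smooth_on_mult = smooth_on_bounded_bilinear[OF bounded_bilinear_mult]
lemmas smooth_on_scaleR = smooth_on_bounded_bilinear[OF bounded_bilinear_scaleR]
lemmas smooth_on_inner = smooth_on_bounded_bilinear[OF bounded_bilinear_inner]

lemma smooth_on_add:
  "open S \<Longrightarrow> smooth_on S f \<Longrightarrow> smooth_on S g \<Longrightarrow> smooth_on S (\<lambda>x. f x + g x)"
  by (simp add: smooth_on_def Ck_on_add)

lemma smooth_on_sum:
  "open S \<Longrightarrow> (\<And>i. i \<in> I \<Longrightarrow> smooth_on S (f i)) \<Longrightarrow> smooth_on S (\<lambda>x. \<Sum>i\<in>I. f i x)"
  by (simp add: smooth_on_def Ck_on_sum)

lemma smooth_on_prod: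
  fixes f :: "'i \<Rightarrow> 'a::real_normed_vector \<Rightarrow> real"
  assumes "open S" "\<And>i. i \<in> I \<Longrightarrow> smooth_on S (f i)"
  shows "smooth_on S (\<lambda>x. \<Prod>i\<in>I. f i x)"
  using assms(2)
  by (induction I rule: infinite_finite_induct) (auto intro: smooth_on_const smooth_on_mult[OF assms(1)])

lemma smooth_on_compose:
  fixes g :: "'a::real_normed_vector \<Rightarrow> 'b::euclidean_space"
  assumes "smooth_on T f" "smooth_on S g" "open S" "open T" "\<And>x. x \<in> S \<Longrightarrow> g x \<in> T"
  shows "smooth_on S (\<lambda>x. f (g x))"
  using assms Ck_on_compose unfolding smooth_on_def by blast

lemma smooth_on_inverse:
  fixes f :: "'a::real_normed_vector \<Rightarrow> real"
  shows "smooth_on S f \<Longrightarrow> open S \<Longrightarrow> (\<And>x. x \<in> S \<Longrightarrow> f x \<noteq> 0) \<Longrightarrow> smooth_on S (\<lambda>x. inverse (f x))"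
  by (rule smooth_on_compose[of "- {0}"]) (auto simp: smooth_on_def Ck_on_inverse)

lemma smooth_on_norm:
  fixes f :: "'a::real_normed_vector \<Rightarrow> 'b::real_inner"
  assumes "smooth_on S f" "open S" "\<And>x. x \<in> S \<Longrightarrow> f x \<noteq> 0"
  shows "smooth_on S (\<lambda>x. norm (f x))"
proof -
  have "smooth_on S (\<lambda>x. sqrt (f x \<bullet> f x))"
    by (rule smooth_on_compose[of "{0<..}"]) (use assms in \<open>auto simp: smooth_on_def Ck_on_sqrt
      intro!: Ck_on_bounded_bilinear[OF bounded_bilinear_inner]\<close>)
  then show ?thesis by (simp add: norm_eq_sqrt_inner)
qed

lemma smooth_on_frechet_derivative:
  "smooth_on S f \<Longrightarrow> smooth_on S (\<lambda>x. frechet_derivative f (at x) v)"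
  unfolding smooth_on_def by (metis Ck_on.simps(2))

lemma smooth_on_has_derivative:
  "smooth_on S f \<Longrightarrow> x \<in> S \<Longrightarrow> (f has_derivative frechet_derivative f (at x)) (at x)"
  using Ck_on_SucD smooth_on_imp_Ck_on by blast

lemma smooth_on_continuous_on: "smooth_on S f \<Longrightarrow> continuous_on S f"
  unfolding smooth_on_def using Ck_on_imp_continuous_on by blast

lemma smooth_on_componentwise:
  fixes f :: "'a::real_normed_vector \<Rightarrow> real^'n"
  assumes "open S" "\<And>i. smooth_on S (\<lambda>x. f x $ i)"
  shows "smooth_on S f"
proof -
  have "smooth_on S (\<lambda>x. \<Sum>i\<in>UNIV. f x $ i *\<^sub>R axis i 1)"
    by (intro smooth_on_sum smooth_on_scaleR smooth_on_const assms)
  then show ?thesis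
    by (rule smooth_on_cong[OF _ assms(1)]) (simp add: basis_expansion flip: scalar_mult_eq_scaleR)
qed

text \<open>By Cramer's rule.\<close>

lemma smooth_on_linear_solution:
  fixes L :: "'a::real_normed_vector \<Rightarrow> real^'n \<Rightarrow> real^'n"
  assumes "open S" "\<And>v. smooth_on S (\<lambda>x. L x v)" "smooth_on S y"
    and L: "\<And>x. x \<in> S \<Longrightarrow> linear (L x)" "\<And>x. x \<in> S \<Longrightarrow> inj (L x)"
    and z: "\<And>x. x \<in> S \<Longrightarrow> L x (z x) = y x"
  shows "smooth_on S z"
proof -
  let ?A = "\<lambda>x k i j. if j = k then y x $ i else matrix (L x) $ i $ j"
  have comp: "smooth_on S (\<lambda>x. f x $ i)" if "smooth_on S f" for f :: "'a \<Rightarrow> real^'n" and i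
  proof -
    have "smooth_on S (\<lambda>x. f x \<bullet> axis i 1)"
      by (intro smooth_on_inner that assms smooth_on_const)
    then show ?thesis by (simp add: inner_axis)
  qed
  have det: "smooth_on S (\<lambda>x. det (\<chi> i j. M x i j))" if "\<And>i j. smooth_on S (\<lambda>x. M x i j)"
    for M :: "'a \<Rightarrow> 'n \<Rightarrow> 'n \<Rightarrow> real"
    unfolding det_def by (auto intro!: smooth_on_sum smooth_on_mult smooth_on_const smooth_on_prod that assms(1))
  have m: "smooth_on S (\<lambda>x. matrix (L x) $ i $ j)" for i j
    unfolding matrix_def by (simp add: comp assms)
  have nz: "det (matrix (L x)) \<noteq> 0" if "x \<in> S" for x
    using L that det_nz_iff_inj by blast
  have eq: "det (\<chi> i j. ?A x k i j) * inverse (det (matrix (L x))) = z x $ k"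
    if "x \<in> S" for x k
  proof -
    have "matrix (L x) *v z x = y x" using L(1) z that by simp
    with cramer[OF nz[OF that], of "z x" "y x"] show ?thesis
      by (simp add: divide_inverse)
  qed
  have A: "smooth_on S (\<lambda>x. ?A x k i j)" for k i j
    by (cases "j = k") (simp_all add: m comp[OF assms(3)])
  have "smooth_on S (\<lambda>x. det (matrix (L x)))"
    using det[of "\<lambda>x i j. matrix (L x) $ i $ j", OF m] by (simp add: vec_lambda_eta)
  then have "smooth_on S (\<lambda>x. det (\<chi> i j. ?A x k i j) * inverse (det (matrix (L x))))" for k
    by (intro smooth_on_mult smooth_on_inverse det[OF A] assms(1) nz)
  then have "smooth_on S (\<lambda>x. z x $ k)" for k
    by (rule smooth_on_cong[OF _ assms(1) eq])
  then show ?thesis by (rule smooth_on_componentwise[OF assms(1)])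
qed

text \<open>The product rule for a matrix function applied to a vector function, when the matrix
  function is known only through its values on fixed vectors.\<close>

lemma has_derivative_linear_family:
  fixes W :: "'a::real_normed_vector \<Rightarrow> 'b::euclidean_space \<Rightarrow> 'c::real_normed_vector"
  assumes "open S" "x \<in> S" "\<And>z. z \<in> S \<Longrightarrow> linear (W z)"
    and W: "\<And>b. ((\<lambda>z. W z b) has_derivative (\<lambda>k. W' k b)) (at x)"
    and u: "(u has_derivative u') (at x)"
  shows "((\<lambda>z. W z (u z)) has_derivative (\<lambda>k. W' k (u x) + W x (u' k))) (at x)"
proof -
  have E: "W z w = (\<Sum>b\<in>Basis. (w \<bullet> b) *\<^sub>R W z b)" if "z \<in> S" for z w
    by (rule linear_Basis_expansion[OF assms(3)[OF that]])
  have "((\<lambda>z. \<Sum>b\<in>Basis. (u z \<bullet> b) *\<^sub>R W z b) has_derivative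
      (\<lambda>k. \<Sum>b\<in>Basis. (u x \<bullet> b) *\<^sub>R W' k b + (u' k \<bullet> b) *\<^sub>R W x b)) (at x)"
    by (auto intro!: derivative_eq_intros W u)
  then have *: "((\<lambda>z. W z (u z)) has_derivative
      (\<lambda>k. \<Sum>b\<in>Basis. (u x \<bullet> b) *\<^sub>R W' k b + (u' k \<bullet> b) *\<^sub>R W x b)) (at x)"
    by (rule has_derivative_transform_within_open[OF _ assms(1,2)]) (simp add: E)
  \<comment> \<open>Linearity of \<open>W' k\<close> is not among the hypotheses. It is recovered at
    the vector \<open>u x\<close> from uniqueness of the derivative of the map sending z to
    \<open>W z (u x)\<close>.\<close>
  have "((\<lambda>z. \<Sum>b\<in>Basis. (u x \<bullet> b) *\<^sub>R W z b) has_derivative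
      (\<lambda>k. \<Sum>b\<in>Basis. (u x \<bullet> b) *\<^sub>R W' k b)) (at x)"
    by (auto intro!: derivative_eq_intros W)
  then have "((\<lambda>z. W z (u x)) has_derivative (\<lambda>k. \<Sum>b\<in>Basis. (u x \<bullet> b) *\<^sub>R W' k b)) (at x)"
    by (rule has_derivative_transform_within_open[OF _ assms(1,2)]) (simp add: E)
  then have "(\<lambda>k. \<Sum>b\<in>Basis. (u x \<bullet> b) *\<^sub>R W' k b) = (\<lambda>k. W' k (u x))"
    using W has_derivative_unique by blast
  then have "(\<Sum>b\<in>Basis. (u x \<bullet> b) *\<^sub>R W' k b) = W' k (u x)" for k by metis
  with * show ?thesis by (simp add: sum.distrib E[OF assms(2), symmetric])
qed

lemma linear_frechet_derivative_family:
  fixes W :: "'a::real_normed_vector \<Rightarrow> 'b::real_vector \<Rightarrow> 'c::real_normed_vector"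
  assumes "open S" "x \<in> S" and lin: "\<And>z. z \<in> S \<Longrightarrow> linear (W z)"
    and D: "\<And>b. (\<lambda>z. W z b) differentiable (at x)"
  shows "linear (\<lambda>b. frechet_derivative (\<lambda>z. W z b) (at x) m)"
proof -
  let ?D = "\<lambda>b. frechet_derivative (\<lambda>z. W z b) (at x)"
  have d: "((\<lambda>z. W z b) has_derivative ?D b) (at x)" for b
    using D frechet_derivative_works by blast
  have *: "?D (r *\<^sub>R y + s *\<^sub>R z) m = r *\<^sub>R ?D y m + s *\<^sub>R ?D z m" for r s y z
  proof -
    have "((\<lambda>x. r *\<^sub>R W x y + s *\<^sub>R W x z) has_derivative (\<lambda>m. r *\<^sub>R ?D y m + s *\<^sub>R ?D z m)) (at x)"
      by (intro derivative_intros d)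
    then have "((\<lambda>x. W x (r *\<^sub>R y + s *\<^sub>R z)) has_derivative (\<lambda>m. r *\<^sub>R ?D y m + s *\<^sub>R ?D z m)) (at x)"
      by (rule has_derivative_transform_within_open[OF _ assms(1,2)])
        (simp add: linear_add[OF lin] linear_cmul[OF lin])
    from has_derivative_unique[OF d this] show ?thesis by (rule fun_cong)
  qed
  show ?thesis
    using *[of 1 _ 1] *[of _ _ 0] by (intro linearI) simp_all
qed

section \<open>The Minkowski norm\<close>

lemma linear_axis_expansion:
  fixes f :: "real^'n \<Rightarrow> 'b::real_vector"
  assumes "linear f"
  shows "f y = (\<Sum>m\<in>UNIV. y $ m *\<^sub>R f (axis m 1))"
proof -
  have "f y = f (\<Sum>m\<in>UNIV. y $ m *\<^sub>R axis m 1)"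
    by (simp add: basis_expansion flip: scalar_mult_eq_scaleR)
  then show ?thesis by (simp add: linear_sum[OF assms] linear_cmul[OF assms])
qed

text \<open>\<open>randers_D1\<close> and \<open>randers_D2\<close> are the first and second derivatives of \<open>F\<^sup>2\<close>, where
  \<open>F = randers_norm \<xi>\<close>.\<close>

definition randers_norm :: "'v::real_inner \<Rightarrow> 'v \<Rightarrow> real" where
  "randers_norm \<xi> v = norm v + \<xi> \<bullet> v"

definition randers_D1 :: "'v::real_inner \<Rightarrow> 'v \<Rightarrow> 'v \<Rightarrow> real" where
  "randers_D1 \<xi> v h = 2 * randers_norm \<xi> v * (v \<bullet> h / norm v + \<xi> \<bullet> h)"

definition randers_D2 :: "'v::real_inner \<Rightarrow> 'v \<Rightarrow> 'v \<Rightarrow> 'v \<Rightarrow> real" where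
  "randers_D2 \<xi> v h w = 2 * (v \<bullet> h / norm v + \<xi> \<bullet> h) * (v \<bullet> w / norm v + \<xi> \<bullet> w) +
     2 * randers_norm \<xi> v * (h \<bullet> w - v \<bullet> h * (v \<bullet> w) / (norm v)\<^sup>2) / norm v"

lemma randers_norm_pos:
  assumes "norm \<xi> < 1" "v \<noteq> 0"
  shows "0 < randers_norm \<xi> v"
proof -
  have "\<bar>\<xi> \<bullet> v\<bar> \<le> norm \<xi> * norm v" by (rule Cauchy_Schwarz_ineq2)
  also have "\<dots> < norm v" using assms by simp
  finally show ?thesis by (simp add: randers_norm_def)
qed

lemma randers_norm_scaleR: "0 \<le> t \<Longrightarrow> randers_norm \<xi> (t *\<^sub>R v) = t * randers_norm \<xi> v"
  by (simp add: randers_norm_def distrib_left)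

lemma has_derivative_norm_compose:
  assumes "(u has_derivative u') (at x)" "u x \<noteq> 0"
  shows "((\<lambda>x. norm (u x)) has_derivative (\<lambda>k. u x \<bullet> u' k / norm (u x))) (at x)"
proof -
  have "((\<lambda>x. norm (u x)) has_derivative (\<lambda>k. u' k \<bullet> sgn (u x))) (at x)"
    using has_derivative_compose[OF assms(1) has_derivative_norm[OF assms(2)]] .
  then show ?thesis
    by (rule has_derivative_eq_rhs)
      (simp add: fun_eq_iff sgn_div_norm inner_commute divide_inverse mult.commute)
qed

lemma has_derivative_randers_norm:
  assumes "(u has_derivative u') (at x)" "u x \<noteq> 0"
  shows "((\<lambda>x. randers_norm \<xi> (u x)) has_derivative
    (\<lambda>k. u x \<bullet> u' k / norm (u x) + \<xi> \<bullet> u' k)) (at x)"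
  unfolding randers_norm_def
  by (rule derivative_eq_intros has_derivative_norm_compose assms refl)+ simp

lemma has_derivative_randers_norm_sq:
  assumes "(u has_derivative u') (at x)" "u x \<noteq> 0"
  shows "((\<lambda>x. (randers_norm \<xi> (u x))\<^sup>2) has_derivative (\<lambda>k. randers_D1 \<xi> (u x) (u' k))) (at x)"
  by (rule has_derivative_eq_rhs, (rule derivative_eq_intros has_derivative_randers_norm assms refl)+)
    (simp add: fun_eq_iff randers_D1_def)

lemma has_derivative_randers_D1:
  assumes "(u has_derivative u') (at x)" "(h has_derivative h') (at x)" "u x \<noteq> 0"
  shows "((\<lambda>x. randers_D1 \<xi> (u x) (h x)) has_derivative
    (\<lambda>k. randers_D2 \<xi> (u x) (h x) (u' k) + randers_D1 \<xi> (u x) (h' k))) (at x)"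
  unfolding randers_D1_def
  by (rule has_derivative_eq_rhs, (rule derivative_eq_intros has_derivative_randers_norm
      has_derivative_norm_compose assms refl | simp add: assms)+)
    (use assms(3) in \<open>simp add: fun_eq_iff randers_D2_def field_simps power2_eq_square inner_commute\<close>)

lemma randers_D2_differentiable:
  assumes u: "u differentiable (at x)" "h differentiable (at x)" "w differentiable (at x)" "u x \<noteq> 0"
  shows "(\<lambda>x. randers_D2 \<xi> (u x) (h x) (w x)) differentiable (at x)"
proof -
  have n: "(\<lambda>x. norm (u x)) differentiable (at x)"
    using has_derivative_norm_compose assms(1,4) unfolding differentiable_def by blast
  have i: "(\<lambda>x. a x \<bullet> b x) differentiable (at x)"
    if "a differentiable (at x)" "b differentiable (at x)" for a b :: "'a \<Rightarrow> 'b"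
    using that has_derivative_inner unfolding differentiable_def by blast
  show ?thesis
    unfolding randers_D2_def randers_norm_def
    by (intro differentiable_add differentiable_mult differentiable_divide differentiable_diff
        differentiable_power n i u differentiable_const) (use u in auto)
qed

lemma randers_D1_linear: "linear (randers_D1 \<xi> v)"
  by (rule linearI) (simp_all add: randers_D1_def algebra_simps inner_add_right add_divide_distrib)

lemma randers_D2_linear: "linear (randers_D2 \<xi> v h)"
  by (rule linearI) (simp_all add: randers_D2_def algebra_simps inner_add_right add_divide_distrib diff_divide_distrib)

lemma randers_D2_commute: "randers_D2 \<xi> v h w = randers_D2 \<xi> v w h"
  unfolding randers_D2_def by (simp only: inner_commute[of h w] mult_ac)

text \<open>Euler's identity: F^2 is homogeneous of degree two, so its first derivative is
  homogeneous of degree one in v.\<close>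

lemma randers_D2_self: "v \<noteq> 0 \<Longrightarrow> randers_D2 \<xi> v h v = randers_D1 \<xi> v h"
  by (simp add: randers_D2_def randers_D1_def randers_norm_def power2_eq_square inner_commute
      algebra_simps add_divide_distrib flip: power2_norm_eq_inner)

text \<open>Up to positive factors the form is a sum of two squares: the derivative of F in
  direction h, and the length of the component of h orthogonal to v. If the second vanishes, then h
  = t v and the first is t F, which is not zero.\<close>

lemma randers_D2_pos:
  assumes "norm \<xi> < 1" "v \<noteq> 0" "h \<noteq> 0"
  shows "0 < randers_D2 \<xi> v h h"
proof -
  let ?p = "v \<bullet> h / norm v + \<xi> \<bullet> h" and ?q = "h \<bullet> h - v \<bullet> h * (v \<bullet> h) / (norm v)\<^sup>2"
  have eq: "randers_D2 \<xi> v h h = 2 * ?p\<^sup>2 + 2 * randers_norm \<xi> v * ?q / norm v"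
    by (simp add: randers_D2_def power2_eq_square)
  have F: "0 < randers_norm \<xi> v" using assms randers_norm_pos by blast
  \<comment> \<open>The coefficient of the orthogonal projection of h onto the line of v.\<close>
  define t where "t = v \<bullet> h / (norm v)\<^sup>2"
  have vv: "v \<bullet> v = (norm v)\<^sup>2" "norm v \<noteq> 0" using assms by (simp_all add: power2_norm_eq_inner)
  have q: "?q = (norm (h - t *\<^sub>R v))\<^sup>2"
    using vv unfolding power2_norm_eq_inner t_def
    by (simp add: inner_diff_left inner_diff_right inner_commute field_simps power2_eq_square)
  show ?thesis
  proof (cases "h = t *\<^sub>R v")
    case True
    then have "t \<noteq> 0" using assms by auto
    have "?p = t * randers_norm \<xi> v"
      by (subst (1 2) True) (use vv in \<open>simp add: randers_norm_def field_simps power2_eq_square\<close>)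
    then have "?p\<^sup>2 > 0" using F \<open>t \<noteq> 0\<close> by simp
    moreover have "?q = 0" using q True by simp
    ultimately show ?thesis unfolding eq by simp
  next
    case False
    then have "0 < ?q" unfolding q by simp
    then have "0 < 2 * randers_norm \<xi> v * ?q / norm v" using F assms(2) by simp
    then show ?thesis unfolding eq using zero_le_power2[of ?p] by linarith
  qed
qed

text \<open>This factor makes the vector paired with \<open>randers_D2\<close> in the next lemma orthogonal to the
  derivative of \<open>F\<close> at \<open>v\<close>, so that only the second summand of \<open>randers_D2\<close> contributes.\<close>

definition randers_spray_factor :: "real \<Rightarrow> 'v::real_inner \<Rightarrow> 'v \<Rightarrow> real" where
  "randers_spray_factor k \<mu> v =
     - (k * ((v \<bullet> v) * (\<mu> \<bullet> \<mu>) - (\<mu> \<bullet> v)\<^sup>2)) / (2 * randers_norm (k *\<^sub>R \<mu>) v)"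

text \<open>The spray equation reduced to R^n. The Riemannian part is orthogonal to v; its pairing
  with the rank one summand of the Hessian is cancelled by the contribution of the radial part,
  computed with Euler's identity. What remains is the angular summand, and it equals the right-hand
  side.\<close>

lemma randers_spray_algebraic:
  fixes \<mu> v :: "'v::real_inner"
  assumes "norm (k *\<^sub>R \<mu>) < 1" "v \<noteq> 0"
  shows "2 * randers_D2 (k *\<^sub>R \<mu>) v h
      ((1/2) *\<^sub>R ((v \<bullet> v) *\<^sub>R \<mu> - (\<mu> \<bullet> v) *\<^sub>R v) + randers_spray_factor k \<mu> v *\<^sub>R v) =
    randers_D1 (k *\<^sub>R \<mu>) v ((\<mu> \<bullet> h) *\<^sub>R v - (\<mu> \<bullet> v) *\<^sub>R h)"
proof -
  let ?\<xi> = "k *\<^sub>R \<mu>" and ?P = "randers_spray_factor k \<mu> v" and ?F = "randers_norm (k *\<^sub>R \<mu>) v"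
  let ?a = "(1/2) *\<^sub>R ((v \<bullet> v) *\<^sub>R \<mu> - (\<mu> \<bullet> v) *\<^sub>R v)" and ?p = "v \<bullet> h / norm v + ?\<xi> \<bullet> h"
  have F: "0 < ?F" using assms randers_norm_pos by blast
  define n where "n = norm v"
  have n: "n > 0" "v \<bullet> v = n * n" using assms(2)
    by (simp_all add: n_def power2_norm_eq_inner flip: power2_eq_square)
  have va: "v \<bullet> ?a = 0" by (simp add: inner_diff_right inner_commute[of v \<mu>])
  have \<xi>a: "?\<xi> \<bullet> ?a = - (?P * ?F)"
    using F by (simp add: randers_spray_factor_def inner_diff_right power2_eq_square field_simps)
  have "2 * randers_D2 ?\<xi> v h ?a = - (4 * ?p * ?P * ?F) + 4 * ?F * (h \<bullet> ?a) / norm v"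
    unfolding randers_D2_def va \<xi>a by simp
  moreover have "2 * randers_D2 ?\<xi> v h (?P *\<^sub>R v) = 4 * ?p * ?P * ?F"
    using linear_cmul[OF randers_D2_linear, of ?\<xi> v h ?P v] randers_D2_self[OF assms(2), of ?\<xi> h]
    by (simp add: randers_D1_def)
  moreover have "4 * ?F * (h \<bullet> ?a) / norm v =
      randers_D1 ?\<xi> v ((\<mu> \<bullet> h) *\<^sub>R v - (\<mu> \<bullet> v) *\<^sub>R h)"
    using n(1) unfolding randers_D1_def n_def[symmetric] n(2)
    by (simp add: inner_diff_right n(2) inner_commute field_simps randers_norm_def)
  ultimately show ?thesis
    using linear_add[OF randers_D2_linear, of ?\<xi> v h ?a "?P *\<^sub>R v"] by simp
qed

lemma randers_spray_factor_scaleR: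
  assumes "0 < t"
  shows "randers_spray_factor k \<mu> (t *\<^sub>R v) = t * randers_spray_factor k \<mu> v"
proof -
  have F: "randers_norm (k *\<^sub>R \<mu>) (t *\<^sub>R v) = t * randers_norm (k *\<^sub>R \<mu>) v"
    by (rule randers_norm_scaleR[OF less_imp_le[OF assms]])
  have e: "- (k * ((t *\<^sub>R v \<bullet> t *\<^sub>R v) * (\<mu> \<bullet> \<mu>) - (\<mu> \<bullet> t *\<^sub>R v)\<^sup>2)) =
      t * (t * - (k * ((v \<bullet> v) * (\<mu> \<bullet> \<mu>) - (\<mu> \<bullet> v)\<^sup>2)))"
    by (simp add: power2_eq_square algebra_simps)
  show ?thesis
    unfolding randers_spray_factor_def F e using assms by simp
qed

section \<open>Spray and Chern connection in a chart\<close>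

text \<open>\<open>W x\<close> is the left trivialisation of the tangent bundle in a chart with range \<open>S\<close>, and
  \<open>L x\<close> is its inverse. The structure assumption is the Maurer-Cartan equation for the bracket
  \<open>[v, w] = (\<mu> \<bullet> v) w - (\<mu> \<bullet> w) v\<close>.\<close>

locale local_randers =
  fixes S :: "(real^'n) set" and W L :: "real^'n \<Rightarrow> real^'n \<Rightarrow> real^'n"
    and k :: real and \<mu> :: "real^'n" and f :: "real^'n \<Rightarrow> real^'n \<Rightarrow> real"
  assumes open_S: "open S"
    and W_linear: "x \<in> S \<Longrightarrow> linear (W x)"
    and W_L: "x \<in> S \<Longrightarrow> W x (L x v) = v"
    and L_W: "x \<in> S \<Longrightarrow> L x (W x y) = y"
    and W_smooth: "smooth_on S (\<lambda>x. W x y)"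
    and k_pos: "0 < k" and k_less: "norm (k *\<^sub>R \<mu>) < 1"
    and W_structure: "x \<in> S \<Longrightarrow>
      frechet_derivative (\<lambda>x. W x z) (at x) y - frechet_derivative (\<lambda>x. W x y) (at x) z =
      (\<mu> \<bullet> W x z) *\<^sub>R W x y - (\<mu> \<bullet> W x y) *\<^sub>R W x z"
    and f_eq: "x \<in> S \<Longrightarrow> f x y = randers_norm (k *\<^sub>R \<mu>) (W x y)"
begin

abbreviation (input) \<xi> where "\<xi> \<equiv> k *\<^sub>R \<mu>"

abbreviation (input) fsq where "fsq \<equiv> (\<lambda>x y. (f x y)\<^sup>2)"

definition W' where "W' x m y = frechet_derivative (\<lambda>x. W x y) (at x) m"

lemma W_nonzero: "x \<in> S \<Longrightarrow> y \<noteq> 0 \<Longrightarrow> W x y \<noteq> 0"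
  by (metis L_W W_linear linear_0)

lemma W_has_derivative_x: "x \<in> S \<Longrightarrow> ((\<lambda>x. W x y) has_derivative (\<lambda>m. W' x m y)) (at x)"
  unfolding W'_def using smooth_on_has_derivative[OF W_smooth] by simp

lemma W_has_derivative_y: "x \<in> S \<Longrightarrow> (W x has_derivative W x) (at y)"
  using W_linear by (simp add: linear_imp_has_derivative)

lemma W'_linear_left: "x \<in> S \<Longrightarrow> linear (\<lambda>m. W' x m y)"
  using W_has_derivative_x has_derivative_linear by blast

lemma W'_linear_right: "x \<in> S \<Longrightarrow> linear (W' x m)"
  using linear_frechet_derivative_family[OF open_S _ W_linear differentiableI[OF W_has_derivative_x]]
  by (simp add: W'_def[abs_def])

lemma dy_fsq:
  assumes "x \<in> S" "y \<noteq> 0"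
  shows "dy l fsq x y = randers_D1 \<xi> (W x y) (W x (axis l 1))"
proof -
  have "((\<lambda>y. (randers_norm \<xi> (W x y))\<^sup>2) has_derivative (\<lambda>m. randers_D1 \<xi> (W x y) (W x m))) (at y)"
    by (rule has_derivative_randers_norm_sq W_has_derivative_y W_nonzero assms)+
  then show ?thesis unfolding dy_def f_eq[OF assms(1)]
    using frechet_derivative_at by metis
qed

lemma dx_fsq:
  assumes "x \<in> S" "y \<noteq> 0"
  shows "dx l fsq x y = randers_D1 \<xi> (W x y) (W' x (axis l 1) y)"
proof -
  have "((\<lambda>x. (randers_norm \<xi> (W x y))\<^sup>2) has_derivative (\<lambda>m. randers_D1 \<xi> (W x y) (W' x m y))) (at x)"
    by (rule has_derivative_randers_norm_sq W_has_derivative_x W_nonzero assms)+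
  then have "((\<lambda>x. fsq x y) has_derivative (\<lambda>m. randers_D1 \<xi> (W x y) (W' x m y))) (at x)"
    by (rule has_derivative_transform_within_open[OF _ open_S assms(1)]) (simp add: f_eq)
  then show ?thesis unfolding dx_def
    using frechet_derivative_at by metis
qed

lemma dx_dy_fsq:
  assumes "x \<in> S" "y \<noteq> 0"
  shows "((\<lambda>x. dy l fsq x y) has_derivative (\<lambda>m. randers_D2 \<xi> (W x y) (W x (axis l 1)) (W' x m y) +
     randers_D1 \<xi> (W x y) (W' x m (axis l 1)))) (at x)"
proof -
  have "((\<lambda>x. randers_D1 \<xi> (W x y) (W x (axis l 1))) has_derivative
     (\<lambda>m. randers_D2 \<xi> (W x y) (W x (axis l 1)) (W' x m y) +
     randers_D1 \<xi> (W x y) (W' x m (axis l 1)))) (at x)"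
    by (rule has_derivative_randers_D1 W_has_derivative_x W_nonzero assms)+
  then show ?thesis
    by (rule has_derivative_transform_within_open[OF _ open_S assms(1)]) (simp add: dy_fsq assms)
qed

lemma dy_dy_fsq:
  assumes "x \<in> S" "y \<noteq> 0"
  shows "((\<lambda>y. dy l fsq x y) has_derivative
    (\<lambda>m. randers_D2 \<xi> (W x y) (W x (axis l 1)) (W x m))) (at y)"
proof -
  have "((\<lambda>y. randers_D1 \<xi> (W x y) (W x (axis l 1))) has_derivative
     (\<lambda>m. randers_D2 \<xi> (W x y) (W x (axis l 1)) (W x m) + randers_D1 \<xi> (W x y) 0)) (at y)"
    by (rule has_derivative_randers_D1 W_has_derivative_y W_nonzero assms has_derivative_const)+
  then have "((\<lambda>y. randers_D1 \<xi> (W x y) (W x (axis l 1))) has_derivative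
     (\<lambda>m. randers_D2 \<xi> (W x y) (W x (axis l 1)) (W x m))) (at y)"
    by (simp add: linear_0[OF randers_D1_linear])
  then show ?thesis
    by (rule has_derivative_transform_within_open[where s = "- {0}"])
      (use assms in \<open>auto simp add: dy_fsq\<close>)
qed

lemma fundamental_tensor_eq:
  assumes "x \<in> S" "y \<noteq> 0"
  shows "fundamental_tensor f x y $ i $ j = 1/2 * randers_D2 \<xi> (W x y) (W x (axis i 1)) (W x (axis j 1))"
proof -
  have "dy i (dy j fsq) x y = randers_D2 \<xi> (W x y) (W x (axis j 1)) (W x (axis i 1))"
    unfolding dy_def[of i] using frechet_derivative_at[OF dy_dy_fsq[OF assms]] by metis
  then show ?thesis by (simp add: fundamental_tensor_def randers_D2_commute)
qed

lemma fundamental_tensor_mult: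
  assumes "x \<in> S" "y \<noteq> 0"
  shows "(fundamental_tensor f x y *v w) $ i = 1/2 * randers_D2 \<xi> (W x y) (W x (axis i 1)) (W x w)"
proof -
  have "linear (\<lambda>w. 1/2 * randers_D2 \<xi> (W x y) (W x (axis i 1)) (W x w))"
    using linear_compose[OF linear_compose[OF W_linear[OF assms(1)] randers_D2_linear]
        linear_scale_self[of "1/2"]] by (simp add: o_def)
  from linear_axis_expansion[OF this, of w] show ?thesis
    by (simp add: matrix_vector_mult_def fundamental_tensor_eq[OF assms] mult_ac)
qed

lemma fundamental_tensor_pos:
  assumes "x \<in> S" "y \<noteq> 0" "w \<noteq> 0"
  shows "0 < w \<bullet> (fundamental_tensor f x y *v w)"
proof -
  have lin: "linear (\<lambda>z. 1/2 * randers_D2 \<xi> (W x y) (W x w) (W x z))"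
    using linear_compose[OF linear_compose[OF W_linear[OF assms(1)] randers_D2_linear]
        linear_scale_self[of "1/2"]] by (simp add: o_def)
  have "w \<bullet> (fundamental_tensor f x y *v w) = 1/2 * randers_D2 \<xi> (W x y) (W x w) (W x w)"
    unfolding linear_axis_expansion[OF lin, of w]
    by (simp add: inner_vec_def fundamental_tensor_mult[OF assms(1,2)] randers_D2_commute)
  then show ?thesis
    using randers_D2_pos[OF k_less W_nonzero[OF assms(1,2)] W_nonzero[OF assms(1,3)]] by simp
qed

lemma fundamental_tensor_inverse:
  assumes "x \<in> S" "y \<noteq> 0"
  shows "matrix_inv (fundamental_tensor f x y) ** fundamental_tensor f x y = mat 1"
proof -
  have "fundamental_tensor f x y *v w \<noteq> 0" if "w \<noteq> 0" for w
    using fundamental_tensor_pos[OF assms that] by auto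
  then have "invertible (fundamental_tensor f x y)"
    unfolding invertible_left_inverse matrix_left_invertible_ker by blast
  then show ?thesis unfolding invertible_def matrix_inv_def by (metis (mono_tags, lifting) someI_ex)
qed

text \<open>For y = z this is the quadratic form of the Levi-Civita connection of the Riemannian
  metric with norm |W x y|. It is not symmetric in y and z; only its diagonal enters the
  spray.\<close>

definition spray_quadratic where
  "spray_quadratic x y z = L x (W' x y z + (W x y \<bullet> W x z) *\<^sub>R \<mu> - (\<mu> \<bullet> W x y) *\<^sub>R W x z)"

text \<open>Multiplied by the fundamental tensor, the spray equation at \<open>y\<close> only involves \<open>v = W x y\<close>, up to
  the term \<open>W' x y y\<close>; the rest is \<open>randers_spray_algebraic\<close>.\<close>

lemma spray_coeff_eq:
  assumes "x \<in> S" "y \<noteq> 0"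
  shows "spray_coeff f i x y =
    1/2 * spray_quadratic x y y $ i + randers_spray_factor k \<mu> (W x y) * y $ i"
proof -
  let ?v = "W x y" and ?P = "randers_spray_factor k \<mu> (W x y)"
  let ?G = "(1/2) *\<^sub>R spray_quadratic x y y + ?P *\<^sub>R y"
  let ?r = "\<lambda>l. (\<Sum>m\<in>UNIV. dx m (dy l fsq) x y * y $ m) - dx l fsq x y"
  let ?a = "(1/2) *\<^sub>R ((?v \<bullet> ?v) *\<^sub>R \<mu> - (\<mu> \<bullet> ?v) *\<^sub>R ?v) + ?P *\<^sub>R ?v"
  have WG: "W x ?G = (1/2) *\<^sub>R W' x y y + ?a"
    by (simp add: linear_add[OF W_linear[OF assms(1)]] linear_cmul[OF W_linear[OF assms(1)]]
        spray_quadratic_def W_L[OF assms(1)] algebra_simps)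
  have r: "?r l = 4 * (fundamental_tensor f x y *v ?G) $ l" for l
  proof -
    let ?w = "W x (axis l 1)"
    let ?T = "\<lambda>m. randers_D2 \<xi> ?v ?w (W' x m y) + randers_D1 \<xi> ?v (W' x m (axis l 1))"
    have dd: "dx m (dy l fsq) x y = ?T (axis m 1)" for m
      unfolding dx_def frechet_derivative_at[OF dx_dy_fsq[OF assms], symmetric] by (rule refl)
    have "linear ?T"
      using has_derivative_linear[OF dx_dy_fsq[OF assms]] .
    from linear_axis_expansion[OF this, of y]
    have "(\<Sum>m\<in>UNIV. dx m (dy l fsq) x y * y $ m) = ?T y"
      unfolding dd by (simp add: mult.commute)
    then have "?r l = randers_D2 \<xi> ?v ?w (W' x y y) +
        randers_D1 \<xi> ?v (W' x y (axis l 1) - W' x (axis l 1) y)"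
      by (simp add: dx_fsq[OF assms] linear_diff[OF randers_D1_linear])
    \<comment> \<open>The Maurer-Cartan equation enters here: apart from \<open>W' x y y\<close>,
      the derivatives of the trivialisation occur only in this antisymmetric combination.\<close>
    also have "W' x y (axis l 1) - W' x (axis l 1) y = (\<mu> \<bullet> ?w) *\<^sub>R ?v - (\<mu> \<bullet> ?v) *\<^sub>R ?w"
      unfolding W'_def by (rule W_structure[OF assms(1)])
    also have "randers_D1 \<xi> ?v \<dots> = 2 * randers_D2 \<xi> ?v ?w ?a"
      by (rule randers_spray_algebraic[OF k_less W_nonzero[OF assms], symmetric])
    also have "randers_D2 \<xi> ?v ?w (W' x y y) + 2 * randers_D2 \<xi> ?v ?w ?a =
        2 * randers_D2 \<xi> ?v ?w (W x ?G)"
      unfolding WG linear_add[OF randers_D2_linear] linear_cmul[OF randers_D2_linear] by simp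
    finally show ?thesis by (simp add: fundamental_tensor_mult[OF assms])
  qed
  have "spray_coeff f i x y =
      (matrix_inv (fundamental_tensor f x y) *v (fundamental_tensor f x y *v ?G)) $ i"
    unfolding spray_coeff_def r by (simp add: matrix_vector_mult_def[of "matrix_inv _"] sum_distrib_left mult_ac)
  also have "\<dots> = ?G $ i"
    unfolding matrix_vector_mul_assoc fundamental_tensor_inverse[OF assms] by simp
  finally show ?thesis by simp
qed

lemma L_linear:
  assumes "x \<in> S"
  shows "linear (L x)"
proof (rule linearI)
  fix a b :: "real^'n" and r :: real
  show "L x (a + b) = L x a + L x b"
    using L_W[OF assms, of "L x a + L x b"] by (simp add: linear_add[OF W_linear] W_L assms)
  show "L x (r *\<^sub>R a) = r *\<^sub>R L x a"
    using L_W[OF assms, of "r *\<^sub>R L x a"] by (simp add: linear_cmul[OF W_linear] W_L assms)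
qed

lemma spray_quadratic_linear_right:
  assumes "x \<in> S"
  shows "linear (spray_quadratic x y)"
  unfolding spray_quadratic_def using W_linear[OF assms] W'_linear_right[OF assms, of y]
  by (intro linearI) (simp_all add: linear_add linear_cmul linear_diff[OF L_linear[OF assms], symmetric]
      linear_add[OF L_linear[OF assms], symmetric] linear_cmul[OF L_linear[OF assms], symmetric]
      inner_add_right algebra_simps)

lemma spray_quadratic_linear_left:
  assumes "x \<in> S"
  shows "linear (\<lambda>y. spray_quadratic x y z)"
  unfolding spray_quadratic_def using W_linear[OF assms]
  by (intro linearI) (simp_all add: linear_add linear_cmul linear_add[OF W'_linear_left[OF assms]]
      linear_cmul[OF W'_linear_left[OF assms]] linear_diff[OF L_linear[OF assms], symmetric]
      linear_add[OF L_linear[OF assms], symmetric] linear_cmul[OF L_linear[OF assms], symmetric]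
      inner_add_right inner_add_left algebra_simps)

lemma spray_coeff_douglas:
  assumes "x \<in> S" "y \<noteq> 0"
  shows "spray_coeff f i x y =
    1/2 * (\<Sum>j\<in>UNIV. \<Sum>k\<in>UNIV. spray_quadratic x (axis j 1) (axis k 1) $ i * y $ j * y $ k) +
    randers_spray_factor k \<mu> (W x y) * y $ i"
proof -
  have "spray_quadratic x y y =
      (\<Sum>j\<in>UNIV. y $ j *\<^sub>R (\<Sum>k\<in>UNIV. y $ k *\<^sub>R spray_quadratic x (axis j 1) (axis k 1)))"
    using linear_axis_expansion[OF spray_quadratic_linear_left[OF assms(1)], of y y]
      linear_axis_expansion[OF spray_quadratic_linear_right[OF assms(1)], of _ y] by simp
  then show ?thesis
    unfolding spray_coeff_eq[OF assms] by (simp add: sum_distrib_left mult_ac)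
qed

lemma spray_factor_homogeneous:
  assumes "x \<in> S" "0 < t"
  shows "randers_spray_factor k \<mu> (W x (t *\<^sub>R y)) = t * randers_spray_factor k \<mu> (W x y)"
  using randers_spray_factor_scaleR[OF assms(2)] linear_cmul[OF W_linear[OF assms(1)]] by simp

text \<open>Smoothness of \<open>W\<close> is given for each fixed vector. Expanding the second
  argument in coordinates turns it into joint smoothness in (x, y).\<close>

lemma f_smooth: "smooth_on (S \<times> (- {0})) (\<lambda>(x, y). f x y)"
proof -
  have o: "open (S \<times> (- {0 :: real^'n}))" by (intro open_Times open_S) auto
  have "smooth_on (S \<times> (- {0 :: real^'n})) (\<lambda>p. W (fst p) (axis m 1))" for m
    using smooth_on_compose[OF W_smooth smooth_on_bounded_linear[OF bounded_linear_fst] o open_S]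
    by auto
  moreover have "bounded_linear (\<lambda>p :: (real^'n) \<times> (real^'n). snd p $ m)" for m
    using bounded_linear_compose[OF bounded_linear_vec_nth bounded_linear_snd] .
  ultimately have "smooth_on (S \<times> (- {0})) (\<lambda>p. \<Sum>m\<in>UNIV. (snd p $ m) *\<^sub>R W (fst p) (axis m 1))"
    by (intro smooth_on_sum smooth_on_scaleR o) (simp_all add: smooth_on_bounded_linear)
  then have W: "smooth_on (S \<times> (- {0})) (\<lambda>p. W (fst p) (snd p))"
    by (rule smooth_on_cong[OF _ o]) (use linear_axis_expansion[OF W_linear] in auto)
  have "smooth_on (S \<times> (- {0})) (\<lambda>p. norm (W (fst p) (snd p)) + (k *\<^sub>R \<mu>) \<bullet> W (fst p) (snd p))"
    by (intro smooth_on_add o smooth_on_norm W smooth_on_inner smooth_on_const)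
      (use W_nonzero in auto)
  then show ?thesis
    by (rule smooth_on_cong[OF _ o]) (auto simp: f_eq randers_norm_def)
qed

section \<open>The Chern connection contracted with y\<close>

text \<open>The Euler identity, which says that the fundamental tensor contracted with y is half the
  y-derivative of F^2, is differentiated in x with y held fixed.\<close>

lemma sum_y_dx_tensor:
  assumes "x \<in> S" "y \<noteq> 0"
  shows "(\<Sum>j\<in>UNIV. y $ j * dx m (\<lambda>x y. fundamental_tensor f x y $ l $ j) x y) =
    1/2 * dx m (dy l fsq) x y"
proof -
  let ?g = "\<lambda>j x. fundamental_tensor f x y $ l $ j"
  have g: "(?g j has_derivative frechet_derivative (?g j) (at x)) (at x)" for j
  proof -
    have "(\<lambda>x. 1/2 * randers_D2 \<xi> (W x y) (W x (axis l 1)) (W x (axis j 1))) differentiable (at x)"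
      by (intro differentiable_mult randers_D2_differentiable differentiable_const
          W_nonzero assms differentiableI[OF W_has_derivative_x])
    then obtain D where "((\<lambda>x. 1/2 * randers_D2 \<xi> (W x y) (W x (axis l 1)) (W x (axis j 1)))
        has_derivative D) (at x)" unfolding differentiable_def ..
    then have "(?g j has_derivative D) (at x)"
      by (rule has_derivative_transform_within_open[OF _ open_S assms(1)])
        (simp add: fundamental_tensor_eq assms)
    then show ?thesis by (metis frechet_derivative_at)
  qed
  have eq: "(\<Sum>j\<in>UNIV. y $ j * ?g j z) = 1/2 * dy l fsq z y" if "z \<in> S" for z
    using fundamental_tensor_mult[OF that assms(2), of y l] randers_D2_self[OF W_nonzero[OF that assms(2)]]
    by (simp add: matrix_vector_mult_def dy_fsq[OF that assms(2)] mult.commute)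
  have "((\<lambda>x. \<Sum>j\<in>UNIV. y $ j * ?g j x) has_derivative
      (\<lambda>h. \<Sum>j\<in>UNIV. y $ j * frechet_derivative (?g j) (at x) h)) (at x)"
    by (intro has_derivative_sum has_derivative_mult_right g)
  then have 1: "((\<lambda>x. 1/2 * dy l fsq x y) has_derivative
      (\<lambda>h. \<Sum>j\<in>UNIV. y $ j * frechet_derivative (?g j) (at x) h)) (at x)"
    by (rule has_derivative_transform_within_open[OF _ open_S assms(1)]) (rule eq)
  have "(\<lambda>x. dy l fsq x y) differentiable (at x)"
    using dx_dy_fsq[OF assms] by (rule differentiableI)
  then have 2: "((\<lambda>x. 1/2 * dy l fsq x y) has_derivative
      (\<lambda>h. 1/2 * frechet_derivative (\<lambda>x. dy l fsq x y) (at x) h)) (at x)"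
    unfolding frechet_derivative_works by (rule has_derivative_mult_right)
  show ?thesis
    unfolding dx_def using fun_cong[OF has_derivative_unique[OF 1 2], of "axis m 1"] .
qed

text \<open>The same Euler identity is differentiated in y. The product rule yields the contraction
  in question plus an entry of the fundamental tensor, and the right-hand side yields that same
  entry.\<close>

lemma sum_y_dy_tensor:
  assumes "x \<in> S" "y \<noteq> 0"
  shows "(\<Sum>j\<in>UNIV. y $ j * dy m (\<lambda>x y. fundamental_tensor f x y $ l $ j) x y) = 0"
proof -
  let ?g = "\<lambda>j y. fundamental_tensor f x y $ l $ j"
  have g: "(?g j has_derivative frechet_derivative (?g j) (at y)) (at y)" for j
  proof -
    have "(\<lambda>y. 1/2 * randers_D2 \<xi> (W x y) (W x (axis l 1)) (W x (axis j 1))) differentiable (at y)"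
      by (intro differentiable_mult randers_D2_differentiable differentiable_const
          W_nonzero assms differentiableI[OF W_has_derivative_y])
    then obtain D where "((\<lambda>y. 1/2 * randers_D2 \<xi> (W x y) (W x (axis l 1)) (W x (axis j 1)))
        has_derivative D) (at y)" unfolding differentiable_def ..
    then have "(?g j has_derivative D) (at y)"
      by (rule has_derivative_transform_within_open[where s = "- {0}"])
        (use assms in \<open>auto simp: fundamental_tensor_eq\<close>)
    then show ?thesis by (metis frechet_derivative_at)
  qed
  have eq: "(\<Sum>j\<in>UNIV. z $ j * ?g j z) = 1/2 * dy l fsq x z" if "z \<noteq> 0" for z
    using fundamental_tensor_mult[OF assms(1) that, of z l] randers_D2_self[OF W_nonzero[OF assms(1) that]]
    by (simp add: matrix_vector_mult_def dy_fsq[OF assms(1) that] mult.commute)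
  have "((\<lambda>y. \<Sum>j\<in>UNIV. y $ j * ?g j y) has_derivative
      (\<lambda>h. \<Sum>j\<in>UNIV. y $ j * frechet_derivative (?g j) (at y) h + h $ j * ?g j y)) (at y)"
    by (intro has_derivative_sum has_derivative_mult g
        bounded_linear_imp_has_derivative bounded_linear_vec_nth)
  then have 1: "((\<lambda>y. 1/2 * dy l fsq x y) has_derivative
      (\<lambda>h. \<Sum>j\<in>UNIV. y $ j * frechet_derivative (?g j) (at y) h + h $ j * ?g j y)) (at y)"
    by (rule has_derivative_transform_within_open[where s = "- {0}"]) (use assms eq in auto)
  have 2: "((\<lambda>y. 1/2 * dy l fsq x y) has_derivative
      (\<lambda>h. 1/2 * randers_D2 \<xi> (W x y) (W x (axis l 1)) (W x h))) (at y)"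
    by (rule has_derivative_mult_right[OF dy_dy_fsq[OF assms]])
  have "(\<Sum>j\<in>UNIV. y $ j * frechet_derivative (?g j) (at y) (axis m 1)) +
      (\<Sum>j\<in>UNIV. axis m 1 $ j * ?g j y) = ?g m y"
    using fun_cong[OF has_derivative_unique[OF 1 2], of "axis m 1"]
    by (simp add: sum.distrib fundamental_tensor_eq[OF assms])
  moreover have "(\<Sum>j\<in>UNIV. axis m 1 $ j * ?g j y) = ?g m y"
    by (simp add: axis_def if_distrib[of "\<lambda>a. a * _"] cong: if_cong)
  ultimately show ?thesis unfolding dy_def by simp
qed

text \<open>Euler's identity for the x-derivative of F^2, which is again homogeneous of degree two
  in y.\<close>

lemma sum_y_dx_dy:
  assumes "x \<in> S" "y \<noteq> 0"
  shows "(\<Sum>l\<in>UNIV. y $ l * (1/2 * dx m (dy l fsq) x y)) = dx m fsq x y"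
proof -
  let ?v = "W x y" and ?w = "W' x (axis m 1) y"
  let ?T = "\<lambda>z. 1/2 * (randers_D2 \<xi> ?v ?w (W x z) + randers_D1 \<xi> ?v (W' x (axis m 1) z))"
  have eq: "1/2 * dx m (dy l fsq) x y = ?T (axis l 1)" for l
    unfolding dx_def frechet_derivative_at[OF dx_dy_fsq[OF assms], symmetric]
    by (simp add: randers_D2_commute)
  have lin: "linear ?T"
    by (rule linearI) (simp_all add: linear_add[OF W_linear[OF assms(1)]] linear_cmul[OF W_linear[OF assms(1)]]
        linear_add[OF W'_linear_right[OF assms(1)]] linear_cmul[OF W'_linear_right[OF assms(1)]]
        linear_add[OF randers_D2_linear] linear_cmul[OF randers_D2_linear]
        linear_add[OF randers_D1_linear] linear_cmul[OF randers_D1_linear] algebra_simps)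
  have "(\<Sum>l\<in>UNIV. y $ l * (1/2 * dx m (dy l fsq) x y)) = ?T y"
    by (simp only: eq linear_axis_expansion[OF lin, of y] real_scaleR_def)
  also have "\<dots> = dx m fsq x y"
    unfolding dx_fsq[OF assms] randers_D2_commute[of _ _ ?w ?v] 
    by (simp add: randers_D2_self[OF W_nonzero[OF assms]] randers_D2_commute[of _ _ ?v ?w])
  finally show ?thesis .
qed

text \<open>The nonlinear connection drops out: the Cartan tensor vanishes when contracted with \<open>y\<close>.\<close>

lemma chern_christoffel_spray:
  assumes "x \<in> S" "y \<noteq> 0"
  shows "(\<Sum>j\<in>UNIV. \<Sum>k\<in>UNIV. chern_christoffel f i j k x y * y $ j * y $ k) = 2 * spray_coeff f i x y"
proof -
  let ?g = "\<lambda>a b x y. fundamental_tensor f x y $ a $ b"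
  let ?h = "\<lambda>k l j. horizontal_deriv f k (?g l j) x y"
  let ?gi = "\<lambda>l. matrix_inv (fundamental_tensor f x y) $ i $ l"
  have h: "(\<Sum>j\<in>UNIV. y $ j * ?h k l j) = 1/2 * dx k (dy l fsq) x y" for k l
  proof -
    have "(\<Sum>j\<in>UNIV. y $ j * ?h k l j) = (\<Sum>j\<in>UNIV. y $ j * dx k (?g l j) x y) -
        (\<Sum>m\<in>UNIV. nonlinear_conn f m k x y * (\<Sum>j\<in>UNIV. y $ j * dy m (?g l j) x y))"
      unfolding horizontal_deriv_def right_diff_distrib sum_subtractf sum_distrib_left
      by (subst (2) sum.swap) (simp add: mult_ac)
    then show ?thesis using sum_y_dx_tensor[OF assms] sum_y_dy_tensor[OF assms] by simp
  qed
  have 1: "(\<Sum>j\<in>UNIV. \<Sum>k\<in>UNIV. y $ j * y $ k * ?h k l j) = (\<Sum>k\<in>UNIV. y $ k * (1/2 * dx k (dy l fsq) x y))" for l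
    unfolding h[symmetric] sum_distrib_left by (subst sum.swap) (simp add: mult_ac)
  have 2: "(\<Sum>j\<in>UNIV. \<Sum>k\<in>UNIV. y $ j * y $ k * ?h j l k) = (\<Sum>k\<in>UNIV. y $ k * (1/2 * dx k (dy l fsq) x y))" for l
    unfolding h[symmetric] sum_distrib_left by (simp add: mult_ac)
  have 3: "(\<Sum>j\<in>UNIV. \<Sum>k\<in>UNIV. y $ j * y $ k * ?h l j k) = dx l fsq x y" for l
    unfolding sum_y_dx_dy[OF assms, symmetric] h[symmetric] sum_distrib_left by (simp add: mult_ac)
  have "(\<Sum>j\<in>UNIV. \<Sum>k\<in>UNIV. chern_christoffel f i j k x y * y $ j * y $ k) =
      (\<Sum>j\<in>UNIV. \<Sum>k\<in>UNIV. \<Sum>l\<in>UNIV. 1/2 * ?gi l * (y $ j * y $ k * (?h k l j + ?h j l k - ?h l j k)))"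
    by (simp add: chern_christoffel_def Let_def sum_distrib_left sum_distrib_right mult_ac)
  also have "\<dots> = (\<Sum>l\<in>UNIV. \<Sum>j\<in>UNIV. \<Sum>k\<in>UNIV. 1/2 * ?gi l * (y $ j * y $ k * (?h k l j + ?h j l k - ?h l j k)))"
    by (subst (2) sum.swap, subst sum.swap) (rule refl)
  also have "\<dots> = (\<Sum>l\<in>UNIV. 1/2 * ?gi l * ((\<Sum>j\<in>UNIV. \<Sum>k\<in>UNIV. y $ j * y $ k * ?h k l j) +
      (\<Sum>j\<in>UNIV. \<Sum>k\<in>UNIV. y $ j * y $ k * ?h j l k) - (\<Sum>j\<in>UNIV. \<Sum>k\<in>UNIV. y $ j * y $ k * ?h l j k)))"
    by (simp add: ring_distribs sum.distrib sum_subtractf sum_distrib_left)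
  \<comment> \<open>The two equal halves \<open>1\<close> and \<open>2\<close> add up to the mixed
    derivative term of the spray, and \<open>3\<close> is its subtracted term. The prefactor 1/2
    against the 1/4 in \<open>spray_coeff\<close> accounts for the factor 2.\<close>
  also have "\<dots> = (\<Sum>l\<in>UNIV. 1/2 * ?gi l * ((\<Sum>m\<in>UNIV. dx m (dy l fsq) x y * y $ m) - dx l fsq x y))"
    unfolding 1 2 3 by (simp add: mult.commute flip: sum.distrib)
  also have "\<dots> = 2 * spray_coeff f i x y"
    by (simp add: spray_coeff_def sum_distrib_left)
  finally show ?thesis .
qed

text \<open>Christoffel symbols independent of \<open>y\<close> would make the spray even in \<open>y\<close>, whereas its part
  proportional to \<open>y\<close> has the strictly negative factor \<open>randers_spray_factor\<close> at both \<open>y\<close> and \<open>- y\<close>.\<close>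

lemma chern_christoffel_not_constant:
  assumes "x \<in> S" "y \<noteq> 0" "\<mu> \<bullet> W x y = 0" "\<mu> \<noteq> 0"
  shows "\<exists>i j k. chern_christoffel f i j k x y \<noteq> chern_christoffel f i j k x (- y)"
proof (rule ccontr)
  assume "\<not> ?thesis"
  then have "spray_coeff f i x y = spray_coeff f i x (- y)" for i
    using chern_christoffel_spray[OF assms(1), of y i] chern_christoffel_spray[OF assms(1), of "- y" i]
      assms(2) by simp
  moreover have W: "W x (- y) = - W x y" using linear_neg[OF W_linear[OF assms(1)]] .
  have "spray_quadratic x (- y) (- y) = spray_quadratic x y y"
    using linear_neg[OF spray_quadratic_linear_right[OF assms(1)], of "- y" y]
      linear_neg[OF spray_quadratic_linear_left[OF assms(1)], of y y] by simp
  ultimately have "(randers_spray_factor k \<mu> (W x y) + randers_spray_factor k \<mu> (- W x y)) * y $ i = 0" for i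
    using spray_coeff_eq[OF assms(1,2), of i] spray_coeff_eq[OF assms(1), of "- y" i] assms(2)
    by (simp add: W algebra_simps)
  then have 0: "randers_spray_factor k \<mu> (W x y) + randers_spray_factor k \<mu> (- W x y) = 0"
    using assms(2) by (auto simp: vec_eq_iff)
  have "randers_spray_factor k \<mu> v < 0" if "v \<noteq> 0" "\<mu> \<bullet> v = 0" for v
    using that k_pos assms(4) randers_norm_pos[OF k_less that(1)]
    by (auto simp: randers_spray_factor_def intro!: divide_neg_pos)
  from this[of "W x y"] this[of "- W x y"] 0 W_nonzero[OF assms(1,2)] assms(3) show False by simp
qed

end

section \<open>Brackets contained in the span, and closed forms\<close>

text \<open>The coefficient of e_j in B(e_i, e_j) does not depend on j: B(e_i, e_j + e_l) lies in
  the span of its arguments, so e_j and e_l occur in it with the same coefficient. This common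
  coefficient is the i-th component of \<open>\<mu>\<close>.\<close>

lemma antisymmetric_bilinear_in_span:
  fixes B :: "real^'n \<Rightarrow> real^'n \<Rightarrow> real^'n"
  assumes lin1: "\<And>w. linear (\<lambda>v. B v w)" and lin2: "\<And>v. linear (B v)"
    and anti: "\<And>v w. B v w = - B w v"
    and span: "\<And>v w. \<exists>a b. B v w = a *\<^sub>R v + b *\<^sub>R w"
  shows "\<exists>\<mu>. \<forall>v w. B v w = (\<mu> \<bullet> v) *\<^sub>R w - (\<mu> \<bullet> w) *\<^sub>R v"
proof -
  define e :: "'n \<Rightarrow> real^'n" where "e i = axis i 1" for i
  have e: "e i $ j = (if i = j then 1 else 0)" for i j by (auto simp: e_def axis_def)
  define q where "q i j = B (e i) (e j) $ j" for i j
  have B_e: "B (e i) (e j) = q i j *\<^sub>R e j - q j i *\<^sub>R e i" if ij: "i \<noteq> j" for i j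
  proof -
    obtain a b where ab: "B (e i) (e j) = a *\<^sub>R e i + b *\<^sub>R e j" using span by blast
    have "q i j = b" "q j i = - a"
      using ij unfolding q_def anti[of "e j" "e i"] ab by (simp_all add: e)
    then show ?thesis using ab by simp
  qed
  have q_eq: "q i j = q i l" if ij: "i \<noteq> j" and il: "i \<noteq> l" for i j l
  proof (cases "j = l")
    case False
    obtain a b where ab: "B (e i) (e j + e l) = a *\<^sub>R e i + b *\<^sub>R (e j + e l)" using span by blast
    then have "B (e i) (e j) + B (e i) (e l) = a *\<^sub>R e i + b *\<^sub>R (e j + e l)"
      by (simp add: linear_add[OF lin2])
    then have *: "q i j *\<^sub>R e j - q j i *\<^sub>R e i + (q i l *\<^sub>R e l - q l i *\<^sub>R e i) =
        a *\<^sub>R e i + b *\<^sub>R (e j + e l)"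
      using ij il by (simp add: B_e)
    have "q i j = b" "q i l = b"
      using arg_cong[OF *, of "\<lambda>v. v $ j"] arg_cong[OF *, of "\<lambda>v. v $ l"] ij il False
      by (simp_all add: e)
    then show ?thesis by simp
  qed simp
  \<comment> \<open>Any second index serves, by \<open>q_eq\<close>. The default 0 is for dimension
    one, where there is no second index and B vanishes by antisymmetry.\<close>
  define \<mu> :: "real^'n" where "\<mu> = (\<chi> i. if \<exists>j. j \<noteq> i then q i (SOME j. j \<noteq> i) else 0)"
  have \<mu>: "\<mu> $ i = q i j" if "i \<noteq> j" for i j
  proof -
    have "(SOME j. j \<noteq> i) \<noteq> i" using that by (metis (mono_tags) someI)
    then have "q i (SOME j. j \<noteq> i) = q i j" using that by (intro q_eq) auto
    moreover have "\<exists>j. j \<noteq> i" using that by metis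
    ultimately show ?thesis unfolding \<mu>_def by simp
  qed
  define R where "R v w = (\<mu> \<bullet> v) *\<^sub>R w - (\<mu> \<bullet> w) *\<^sub>R v" for v w
  have R1: "linear (\<lambda>v. R v w)" and R2: "linear (R v)" for v w
    by (rule linearI; simp add: R_def inner_add_right algebra_simps)+
  have "B (e i) (e j) = R (e i) (e j)" for i j
  proof (cases "i = j")
    case True
    have "B (e i) (e i) + B (e i) (e i) = 0" using anti[of "e i" "e i"] by (metis add.right_inverse)
    then have "B (e i) (e i) = 0" by (simp flip: scaleR_2)
    then show ?thesis using True by (simp add: R_def)
  next
    case False
    then show ?thesis using B_e[OF False] \<mu>[OF False] \<mu>[of j i]
      by (simp add: R_def e_def inner_axis)
  qed
  then have "B v (e j) = R v (e j)" for v j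
    using linear_axis_expansion[OF lin1, of v "e j"] linear_axis_expansion[OF R1, of v "e j"]
    by (simp add: e_def)
  then have "B v w = R v w" for v w
    using linear_axis_expansion[OF lin2, of v w] linear_axis_expansion[OF R2, of v w]
    by (simp add: e_def)
  then show ?thesis unfolding R_def by blast
qed

text \<open>Poincare's lemma with the usual potential: the integral of the form along the segment
  from a fixed point a to x. Differentiation under the integral sign and closedness turn the
  integrand into a total derivative in t.\<close>

lemma closed_one_form_exact:
  fixes W :: "'a::euclidean_space \<Rightarrow> 'a \<Rightarrow> 'b::euclidean_space"
  assumes S: "open S" "convex S"
    and lin: "\<And>x. x \<in> S \<Longrightarrow> linear (W x)"
    and smooth: "\<And>y. smooth_on S (\<lambda>x. W x y)"
    and closed: "\<And>x y z. x \<in> S \<Longrightarrow> frechet_derivative (\<lambda>x. W x z) (at x) y =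
      frechet_derivative (\<lambda>x. W x y) (at x) z"
  shows "\<exists>\<phi>. \<forall>x\<in>S. (\<phi> has_derivative W x) (at x)"
proof (cases "S = {}")
  case False
  then obtain a where a: "a \<in> S" by blast
  define W' where "W' x m y = frechet_derivative (\<lambda>x. W x y) (at x) m" for x m y
  have D: "((\<lambda>x. W x y) has_derivative (\<lambda>m. W' x m y)) (at x)" if "x \<in> S" for x y
    unfolding W'_def using smooth_on_has_derivative[OF smooth that] by simp
  have W'_cont: "continuous_on S (\<lambda>x. W' x m y)" for m y
    unfolding W'_def by (intro smooth_on_continuous_on smooth_on_frechet_derivative smooth)
  have W'_lin: "linear (\<lambda>m. W' x m y)" if "x \<in> S" for x y
    using D[OF that] has_derivative_linear by blast
  have W'_sym: "W' x y z = W' x z y" if "x \<in> S" for x y z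
    unfolding W'_def using closed[OF that] .
  define c where "c t x = a + t *\<^sub>R (x - a)" for t :: real and x
  have c: "c t x \<in> S" if "x \<in> S" "t \<in> {0..1}" for t x
  proof -
    have "c t x = (1 - t) *\<^sub>R a + t *\<^sub>R x" by (simp add: c_def algebra_simps)
    then show ?thesis using convexD_alt[OF S(2) a that(1)] that(2) by auto
  qed
  \<comment> \<open>The x-derivative of the integrand of the potential, packaged as a bounded linear
    map as \<open>leibniz_rule\<close> expects.\<close>
  define G where "G x t = Blinfun (\<lambda>k. W' (c t x) (t *\<^sub>R k) (x - a) + W (c t x) k)" for x t
  have der: "((\<lambda>x. W (c t x) (x - a)) has_derivative
      (\<lambda>k. W' (c t x) (t *\<^sub>R k) (x - a) + W (c t x) k)) (at x)" if "x \<in> S" "t \<in> {0..1}" for t x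
  proof (rule has_derivative_linear_family[OF S(1) that(1), where W = "\<lambda>z. W (c t z)" and
        W' = "\<lambda>k b. W' (c t x) (t *\<^sub>R k) b" and u = "\<lambda>z. z - a" and u' = "\<lambda>k. k"])
    show "linear (W (c t z))" if "z \<in> S" for z using lin c \<open>t \<in> _\<close> that by blast
    have "(c t has_derivative (\<lambda>k. t *\<^sub>R k)) (at x)"
      unfolding c_def by (auto intro!: derivative_eq_intros)
    from has_derivative_compose[OF this D[OF c[OF that]]]
    show "((\<lambda>z. W (c t z) b) has_derivative (\<lambda>k. W' (c t x) (t *\<^sub>R k) b)) (at x)" for b .
  qed (auto intro!: derivative_eq_intros)
  have G: "blinfun_apply (G x t) = (\<lambda>k. W' (c t x) (t *\<^sub>R k) (x - a) + W (c t x) k)"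
    if "x \<in> S" "t \<in> {0..1}" for t x
    unfolding G_def using has_derivative_bounded_linear[OF der[OF that]]
    by (rule bounded_linear_Blinfun_apply)
  have c_cont: "continuous_on T (\<lambda>(x, t). c t x)" for T
    unfolding c_def by (auto simp: split_beta intro!: continuous_intros)
  have W_cont: "continuous_on (S \<times> cbox 0 1) (\<lambda>p. W (c (snd p) (fst p)) y)" for y
    by (rule continuous_on_compose2[OF smooth_on_continuous_on[OF smooth]
        c_cont[unfolded split_beta]]) (use c in auto)
  have W'_cont2: "continuous_on (S \<times> cbox 0 1) (\<lambda>p. W' (c (snd p) (fst p)) m y)" for y m
    by (rule continuous_on_compose2[OF W'_cont c_cont[unfolded split_beta]]) (use c in auto)
  have G_cont: "continuous_on (S \<times> cbox 0 1) (\<lambda>(x, t). G x t)"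
  proof (rule continuous_on_blinfun_componentwise)
    fix i :: 'a
    \<comment> \<open>Closedness exchanges the two slots of \<open>W'\<close>, which puts the
      varying vector x - a into the slot known to be linear. Expanding it in \<open>Basis\<close>
      leaves only fixed vectors, for which continuity is known.\<close>
    have "continuous_on (S \<times> cbox 0 1) (\<lambda>p. snd p *\<^sub>R (\<Sum>b\<in>Basis. ((fst p - a) \<bullet> b) *\<^sub>R
        W' (c (snd p) (fst p)) b i) + W (c (snd p) (fst p)) i)"
      by (intro continuous_intros W_cont W'_cont2)
    moreover have "snd p *\<^sub>R (\<Sum>b\<in>Basis. ((fst p - a) \<bullet> b) *\<^sub>R W' (c (snd p) (fst p)) b i) +
        W (c (snd p) (fst p)) i = (case p of (x, t) \<Rightarrow> G x t) i" if "p \<in> S \<times> cbox 0 1" for p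
    proof -
      obtain x t where p: "p = (x, t)" "x \<in> S" "t \<in> {0..1}" using \<open>p \<in> _\<close> by (cases p) auto
      note l = W'_lin[OF c[OF p(2,3)]]
      show ?thesis
        using linear_Basis_expansion[OF l, of "x - a" i] W'_sym[OF c[OF p(2,3)], of i "x - a"]
        by (simp add: p(1) G[OF p(2,3)] linear_cmul[OF l])
    qed
    ultimately show "continuous_on (S \<times> cbox 0 1) (\<lambda>p. (case p of (x, t) \<Rightarrow> G x t) i)"
      by (simp cong: continuous_on_cong)
  qed
  define \<phi> where "\<phi> x = integral (cbox 0 1) (\<lambda>t. W (c t x) (x - a))" for x
  have "(\<phi> has_derivative W x) (at x)" if x: "x \<in> S" for x
  proof -
    have int: "(\<lambda>t. W (c t x) (x - a)) integrable_on cbox 0 1" if "x \<in> S" for x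
    proof (rule integrable_continuous)
      show "continuous_on (cbox 0 1) (\<lambda>t. W (c t x) (x - a))"
        by (rule continuous_on_compose2[OF smooth_on_continuous_on[OF smooth]])
          (use c that in \<open>auto simp: c_def intro!: continuous_intros\<close>)
    qed
    have "((\<lambda>x. integral (cbox 0 1) (\<lambda>t. W (c t x) (x - a))) has_derivative
        integral (cbox 0 1) (G x)) (at x within S)"
      by (rule leibniz_rule[OF _ int G_cont x S(2)])
        (use der G in \<open>auto intro: has_derivative_at_withinI\<close>)
    then have *: "(\<phi> has_derivative blinfun_apply (integral (cbox 0 1) (G x))) (at x)"
      unfolding \<phi>_def using at_within_open[OF x S(1)] by simp
    have "integral (cbox 0 1) (G x) k = W x k" for k
    proof -
      have "continuous_on (cbox 0 1) (\<lambda>t. (\<lambda>(x, t). G x t) (x, t))"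
        by (rule continuous_on_compose2[OF G_cont]) (use x in \<open>auto intro!: continuous_intros\<close>)
      then have "G x integrable_on cbox 0 1" by (intro integrable_continuous) simp
      then have "integral (cbox 0 1) (G x) k = integral (cbox 0 1) (\<lambda>t. G x t k)"
        by (rule integral_linear[OF _ blinfun.bounded_linear_left[of k], unfolded o_def, symmetric])
      also have "\<dots> = integral {0..1} (\<lambda>t. W (c t x) k + t *\<^sub>R W' (c t x) (x - a) k)"
        unfolding cbox_interval
        by (rule integral_cong) (simp add: G[OF x] linear_cmul[OF W'_lin[OF c[OF x]]] W'_sym[OF c[OF x], where y = k])
      also have "\<dots> = W x k"
      proof -
        \<comment> \<open>The primitive vanishes at t = 0 and equals \<open>W x k\<close> at t =
          1.\<close>
        have "((\<lambda>t. t *\<^sub>R W (c t x) k) has_vector_derivative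
            W (c t x) k + t *\<^sub>R W' (c t x) (x - a) k) (at t within {0..1})" if t: "t \<in> {0..1}" for t
        proof -
          have "((\<lambda>t. c t x) has_derivative (\<lambda>s. s *\<^sub>R (x - a))) (at t within {0..1})"
            unfolding c_def by (auto intro!: derivative_eq_intros)
          from has_derivative_compose[OF this D[OF c[OF x t]]]
          have "((\<lambda>t. W (c t x) k) has_derivative (\<lambda>s. s *\<^sub>R W' (c t x) (x - a) k)) (at t within {0..1})"
            by (simp add: linear_cmul[OF W'_lin[OF c[OF x t]]])
          then show ?thesis unfolding has_vector_derivative_def
            by (auto intro!: derivative_eq_intros simp: fun_eq_iff algebra_simps)
        qed
        from fundamental_theorem_of_calculus[OF _ this]
        have "((\<lambda>t. W (c t x) k + t *\<^sub>R W' (c t x) (x - a) k) has_integral W x k) {0..1}"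
          by (simp add: c_def)
        then show ?thesis by (rule integral_unique)
      qed
      finally show ?thesis .
    qed
    then have "blinfun_apply (integral (cbox 0 1) (G x)) = W x" by (rule ext)
    with * show ?thesis by simp
  qed
  then show ?thesis by blast
qed simp

section \<open>Left invariant frames\<close>

locale vec_lie_group = lie_group mul e inve A
  for mul :: "'g::{t2_space, second_countable_topology} \<Rightarrow> 'g \<Rightarrow> 'g" and e :: 'g
    and inve :: "'g \<Rightarrow> 'g" and A :: "('g, real^'n) chart set"
begin

lemma is_chart: "c \<in> A \<Longrightarrow> is_chart c"
proof -
  have "\<forall>c\<in>A. is_chart c"
    using smooth_structure unfolding smooth_structure_def by (elim conjE)
  then show "c \<in> A \<Longrightarrow> is_chart c" by blast
qed

lemma chart_facts:
  assumes "c \<in> A"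
  shows "open (cdom c)" "open (crange c)" "continuous_on (cdom c) (cmap c)"
    "continuous_on (crange c) (cinv c)"
  using is_chart[OF assms] unfolding is_chart_def homeomorphism_def by simp_all

lemma cinv_cmap [simp]: "c \<in> A \<Longrightarrow> p \<in> cdom c \<Longrightarrow> cinv c (cmap c p) = p"
  using is_chart[of c] unfolding is_chart_def homeomorphism_def by simp

lemma cmap_cinv [simp]: "c \<in> A \<Longrightarrow> x \<in> crange c \<Longrightarrow> cmap c (cinv c x) = x"
  by auto

lemma cinv_in_cdom [simp]: "c \<in> A \<Longrightarrow> x \<in> crange c \<Longrightarrow> cinv c x \<in> cdom c"
  by auto

lemma chart_at: "\<exists>c. c \<in> A \<and> p \<in> cdom c"
proof -
  have "(\<Union>c\<in>A. cdom c) = UNIV"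
    using smooth_structure unfolding smooth_structure_def by (elim conjE)
  then show ?thesis by blast
qed

lemma continuous_mul:
  assumes "continuous_on S f" "continuous_on S g"
  shows "continuous_on S (\<lambda>x. mul (f x) (g x))"
proof -
  have "continuous_on UNIV (\<lambda>(x, y). mul x y)"
    using smooth_mult unfolding smooth_map_def by blast
  from continuous_on_compose2[OF this continuous_on_Pair[OF assms]] show ?thesis by simp
qed

section \<open>Group multiplication and left translations in coordinates\<close>

definition mul_dom where
  "mul_dom c d k = {(x, y). x \<in> crange c \<and> y \<in> crange d \<and> mul (cinv c x) (cinv d y) \<in> cdom k}"

definition mul_coord where
  "mul_coord c d k = (\<lambda>(x, y). cmap k (mul (cinv c x) (cinv d y)))"

lemma open_mul_dom:
  assumes "c \<in> A" "d \<in> A" "k \<in> A"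
  shows "open (mul_dom c d k)"
proof -
  have "continuous_on (crange c \<times> crange d) (\<lambda>z. mul (cinv c (fst z)) (cinv d (snd z)))"
    by (intro continuous_mul continuous_on_compose2[OF chart_facts(4)[OF assms(1)]]
        continuous_on_compose2[OF chart_facts(4)[OF assms(2)]] continuous_intros) auto
  from continuous_open_preimage[OF this _ chart_facts(1)[OF assms(3)]]
  have "open (crange c \<times> crange d \<inter> (\<lambda>z. mul (cinv c (fst z)) (cinv d (snd z))) -` cdom k)"
    using chart_facts(2) assms open_Times by blast
  also have "crange c \<times> crange d \<inter> (\<lambda>z. mul (cinv c (fst z)) (cinv d (snd z))) -` cdom k = mul_dom c d k"
    by (auto simp: mul_dom_def)
  finally show ?thesis .
qed

lemma smooth_mul_coord:
  assumes "c \<in> A" "d \<in> A" "k \<in> A"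
  shows "smooth_on (mul_dom c d k) (mul_coord c d k)"
proof -
  define pc where "pc = (cdom c \<times> cdom d, map_prod (cmap c) (cmap d))"
  have inv: "cinv pc (x, y) = (cinv c x, cinv d y)" if "x \<in> crange c" "y \<in> crange d" for x y
  proof -
    have "inj_on (map_prod (cmap c) (cmap d)) (cdom c \<times> cdom d)"
      using assms by (intro map_prod_inj_on inj_on_inverseI[of _ "cinv c"] inj_on_inverseI[of _ "cinv d"]) simp_all
    then have "inv_into (cdom c \<times> cdom d) (map_prod (cmap c) (cmap d)) (x, y) = (cinv c x, cinv d y)"
      by (rule inv_into_f_eq) (simp_all only: mem_Sigma_iff map_prod_simp cmap_cinv cinv_in_cdom assms that)
    then show ?thesis by (simp only: cinv_def pc_def fst_conv snd_conv)
  qed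
  have "pc \<in> prod_atlas A A" using assms unfolding prod_atlas_def pc_def by blast
  then have "smooth_on (cmap pc ` (cdom pc \<inter> (\<lambda>(x, y). mul x y) -` cdom k))
      (cmap k \<circ> (\<lambda>(x, y). mul x y) \<circ> cinv pc)"
    using smooth_mult assms unfolding smooth_map_def by blast
  moreover have "cmap pc ` (cdom pc \<inter> (\<lambda>(x, y). mul x y) -` cdom k) = mul_dom c d k"
  proof (intro set_eqI iffI)
    fix z assume "z \<in> cmap pc ` (cdom pc \<inter> (\<lambda>(x, y). mul x y) -` cdom k)"
    then obtain p q where "z = (cmap c p, cmap d q)" "p \<in> cdom c" "q \<in> cdom d" "mul p q \<in> cdom k"
      by (auto simp: pc_def)
    then show "z \<in> mul_dom c d k" using assms by (simp add: mul_dom_def)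
  next
    fix z assume "z \<in> mul_dom c d k"
    then obtain x y where z: "z = (x, y)" "x \<in> crange c" "y \<in> crange d"
      "mul (cinv c x) (cinv d y) \<in> cdom k" by (auto simp: mul_dom_def)
    then show "z \<in> cmap pc ` (cdom pc \<inter> (\<lambda>(x, y). mul x y) -` cdom k)"
      using assms by (intro image_eqI[of _ _ "(cinv c x, cinv d y)"])
        (simp_all only: pc_def fst_conv snd_conv map_prod_simp cmap_cinv cinv_in_cdom Int_iff
          mem_Sigma_iff vimage_eq prod.case simp_thms)
  qed
  ultimately have "smooth_on (mul_dom c d k) (cmap k \<circ> (\<lambda>(x, y). mul x y) \<circ> cinv pc)" by simp
  then show ?thesis
  proof (rule smooth_on_cong[OF _ open_mul_dom[OF assms]])
    fix z assume "z \<in> mul_dom c d k"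
    then obtain x y where "z = (x, y)" "x \<in> crange c" "y \<in> crange d" unfolding mul_dom_def by blast
    then show "(cmap k \<circ> (\<lambda>(x, y). mul x y) \<circ> cinv pc) z = mul_coord c d k z"
      by (simp only: mul_coord_def o_apply inv prod.case)
  qed
qed

text \<open>The derivative at \<open>p\<close> of the left translation by \<open>a\<close>, read in the chart \<open>c\<close> around \<open>p\<close> and
  the chart \<open>k\<close> around \<open>mul a p\<close>. For \<open>a = e\<close> this is a change of coordinates, so that the chain
  rule \<open>TD_chain\<close> also covers the transformation of tangent vectors.\<close>

definition TD where
  "TD a c k p = frechet_derivative (\<lambda>x. cmap k (mul a (cinv c x))) (at (cmap c p))"

text \<open>Translation by a is multiplication with its first argument frozen. Reading its
  derivative as a partial derivative of the multiplication makes the smooth dependence on a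
  available.\<close>

lemma translation_has_derivative_mul_coord:
  assumes "d \<in> A" "c \<in> A" "k \<in> A" "a \<in> cdom d" "p \<in> cdom c" "mul a p \<in> cdom k"
  shows "((\<lambda>x. cmap k (mul a (cinv c x))) has_derivative
    (\<lambda>v. frechet_derivative (mul_coord d c k) (at (cmap d a, cmap c p)) (0, v))) (at (cmap c p))"
proof -
  have mem: "(cmap d a, cmap c p) \<in> mul_dom d c k" using assms by (auto simp: mul_dom_def)
  have "((\<lambda>x. (cmap d a, x)) has_derivative (\<lambda>v. (0, v))) (at (cmap c p))"
    by (auto intro!: derivative_eq_intros)
  from has_derivative_compose[OF this smooth_on_has_derivative[OF smooth_mul_coord[OF assms(1-3)] mem]]
  show ?thesis using assms(1,4) by (simp add: mul_coord_def)
qed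

lemma TD_eq_mul_coord:
  assumes "d \<in> A" "c \<in> A" "k \<in> A" "a \<in> cdom d" "p \<in> cdom c" "mul a p \<in> cdom k"
  shows "TD a c k p v = frechet_derivative (mul_coord d c k) (at (cmap d a, cmap c p)) (0, v)"
  unfolding TD_def using fun_cong[OF frechet_derivative_at[OF translation_has_derivative_mul_coord[OF assms]], of v]
  by (rule sym)

lemma translation_has_derivative:
  assumes "c \<in> A" "k \<in> A" "p \<in> cdom c" "mul a p \<in> cdom k"
  shows "((\<lambda>x. cmap k (mul a (cinv c x))) has_derivative TD a c k p) (at (cmap c p))"
proof -
  obtain d where "d \<in> A" "a \<in> cdom d" using chart_at by blast
  from translation_has_derivative_mul_coord[OF this(1) assms(1,2) this(2) assms(3,4)]
  show ?thesis unfolding TD_def using frechet_derivative_works differentiableI by blast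
qed

lemma TD_linear:
  assumes "c \<in> A" "k \<in> A" "p \<in> cdom c" "mul a p \<in> cdom k"
  shows "linear (TD a c k p)"
  using translation_has_derivative[OF assms] by (rule has_derivative_linear)

lemma TD_chain:
  assumes "c \<in> A" "d \<in> A" "k \<in> A" "p \<in> cdom c" "mul a p \<in> cdom d" "mul b (mul a p) \<in> cdom k"
  shows "TD b d k (mul a p) (TD a c d p y) = TD (mul b a) c k p y"
proof -
  have 1: "((\<lambda>x. cmap d (mul a (cinv c x))) has_derivative TD a c d p) (at (cmap c p))"
    by (rule translation_has_derivative) (use assms in auto)
  have 2: "((\<lambda>x. cmap k (mul b (cinv d x))) has_derivative TD b d k (mul a p))
      (at (cmap d (mul a (cinv c (cmap c p)))))"
    using translation_has_derivative[of d k "mul a p" b] assms by simp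
  \<comment> \<open>On this neighbourhood the intermediate point stays in the domain of
    \<open>d\<close>, so that \<open>cinv d\<close> undoes \<open>cmap d\<close>.\<close>
  let ?U = "crange c \<inter> (\<lambda>x. mul a (cinv c x)) -` cdom d"
  have U: "open ?U"
    by (intro continuous_open_preimage continuous_mul continuous_on_const chart_facts assms)
  have "((\<lambda>x. cmap k (mul (mul b a) (cinv c x))) has_derivative
      (\<lambda>y. TD b d k (mul a p) (TD a c d p y))) (at (cmap c p))"
    by (rule has_derivative_transform_within_open[OF has_derivative_compose[OF 1 2] U])
      (use assms in \<open>auto simp: assoc\<close>)
  from fun_cong[OF frechet_derivative_at[OF this], of y] show ?thesis
    unfolding TD_def[of "mul b a"] .
qed

lemma TD_id:
  assumes "c \<in> A" "p \<in> cdom c"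
  shows "TD e c c p y = y"
proof -
  have "((\<lambda>x. cmap c (mul e (cinv c x))) has_derivative (\<lambda>y. y)) (at (cmap c p))"
    by (rule has_derivative_transform_within_open[OF has_derivative_ident chart_facts(2)[OF assms(1)]])
      (use assms in \<open>auto simp: group_left_neutral\<close>)
  from fun_cong[OF frechet_derivative_at[OF this], of y] show ?thesis
    unfolding TD_def by (rule sym)
qed

lemma transition_eq_TD:
  "frechet_derivative (cmap d \<circ> cinv c) (at (cmap c p)) = TD e c d p"
  by (simp add: TD_def group_left_neutral o_def)

lemma tangent_spaceD:
  assumes "v \<in> tangent_space A p" "c \<in> A" "d \<in> A" "p \<in> cdom c" "p \<in> cdom d"
  shows "v d = TD e c d p (v c)"
  using assms unfolding tangent_space_def transition_eq_TD by blast

lemma tangent_space_iff: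
  "v \<in> tangent_space A p \<longleftrightarrow>
    (\<forall>c\<in>A. \<forall>d\<in>A. p \<in> cdom c \<longrightarrow> p \<in> cdom d \<longrightarrow> v d = TD e c d p (v c)) \<and>
    (\<forall>c. \<not> (c \<in> A \<and> p \<in> cdom c) \<longrightarrow> v c = 0)"
  unfolding tangent_space_def transition_eq_TD by blast

lemma differential_eq:
  assumes "v \<in> tangent_space A p" "c \<in> A" "p \<in> cdom c"
  shows "differential A A (mul a) p v =
    (\<lambda>d. if d \<in> A \<and> mul a p \<in> cdom d then TD a c d p (v c) else 0)"
proof
  fix d
  define c' where "c' = (SOME c. c \<in> A \<and> p \<in> cdom c)"
  have c': "c' \<in> A" "p \<in> cdom c'" using someI_ex[OF chart_at, of p] unfolding c'_def by auto
  have "TD a c' d p (v c') = TD a c d p (v c)" if "d \<in> A" "mul a p \<in> cdom d"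
    using TD_chain[of c c' d p e a "v c"] tangent_spaceD[OF assms(1,2) c'(1) assms(3) c'(2)] assms c' that
    by (simp add: group_left_neutral right_neutral)
  then show "differential A A (mul a) p v d =
      (if d \<in> A \<and> mul a p \<in> cdom d then TD a c d p (v c) else 0)"
    unfolding differential_def c'_def[symmetric] Let_def TD_def o_def by simp
qed

lemma coord_tvec_eq:
  "coord_tvec A c p y = (\<lambda>d. if d \<in> A \<and> p \<in> cdom d then TD e c d p y else 0)"
  unfolding coord_tvec_def transition_eq_TD ..

lemma coord_tvec_tangent:
  assumes "c \<in> A" "p \<in> cdom c"
  shows "coord_tvec A c p y \<in> tangent_space A p"
  unfolding tangent_space_iff coord_tvec_eq
  using TD_chain[of c _ _ p e e y] assms by (auto simp: group_left_neutral)

definition c0 where "c0 = (SOME c. c \<in> A \<and> e \<in> cdom c)"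

lemma c0: "c0 \<in> A" "e \<in> cdom c0"
  using someI_ex[OF chart_at, of e] unfolding c0_def by auto

text \<open>The left invariant vector field with value \<open>v\<close> at \<open>e\<close>, and the translation of a tangent
  vector at \<open>p\<close> to \<open>e\<close>; both use the components in the chart \<open>c0\<close>.\<close>

definition frame where
  "frame v p = (\<lambda>d. if d \<in> A \<and> p \<in> cdom d then TD p c0 d e v else 0)"

definition coframe where
  "coframe p u = differential A A (mul (inve p)) p u c0"

lemma coframe_eq:
  assumes "u \<in> tangent_space A p" "c \<in> A" "p \<in> cdom c"
  shows "coframe p u = TD (inve p) c c0 p (u c)"
  unfolding coframe_def differential_eq[OF assms] using c0 by simp

lemma coframe_inj:
  assumes "c \<in> A" "p \<in> cdom c"
  shows "TD p c0 c e (TD (inve p) c c0 p y) = y"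
  using TD_chain[of c c0 c p "inve p" p y] assms c0 TD_id[OF assms]
  by (simp add: right_inverse right_neutral)

lemma coframe_surj:
  assumes "c \<in> A" "p \<in> cdom c"
  shows "TD (inve p) c c0 p (TD p c0 c e v) = v"
  using TD_chain[of c0 c c0 e p "inve p" v] assms c0 TD_id[OF c0]
  by (simp add: right_neutral)

lemma frame_tangent: "frame v p \<in> tangent_space A p"
  unfolding tangent_space_iff frame_def
  using TD_chain[of c0 _ _ e p e v] c0 by (auto simp: group_left_neutral right_neutral)

lemma coframe_frame: "coframe p (frame v p) = v"
proof -
  obtain c where c: "c \<in> A" "p \<in> cdom c" using chart_at by blast
  then show ?thesis using coframe_eq[OF frame_tangent c, of v] coframe_surj[OF c]
    by (simp add: frame_def)
qed

lemma frame_coframe: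
  assumes "u \<in> tangent_space A p"
  shows "frame (coframe p u) p = u"
proof
  fix d
  show "frame (coframe p u) p d = u d"
  proof (cases "d \<in> A \<and> p \<in> cdom d")
    case True
    then show ?thesis using coframe_eq[OF assms, of d] coframe_inj[of d p "u d"]
      by (simp add: frame_def)
  next
    case False
    then have "u d = 0" using assms unfolding tangent_space_iff by blast
    with False show ?thesis by (auto simp: frame_def)
  qed
qed

lemma differential_tangent:
  assumes "u \<in> tangent_space A p"
  shows "differential A A (mul a) p u \<in> tangent_space A (mul a p)"
proof -
  obtain c where c: "c \<in> A" "p \<in> cdom c" using chart_at by blast
  show ?thesis unfolding tangent_space_iff differential_eq[OF assms c]
    using TD_chain[of c _ _ p a e "u c"] c by (auto simp: group_left_neutral)
qed

text \<open>Left invariance of the Maurer-Cartan form, from the group identity (a p)^(-1) a = p^(-1)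
  and the chain rule.\<close>

lemma coframe_differential:
  assumes "u \<in> tangent_space A p"
  shows "coframe (mul a p) (differential A A (mul a) p u) = coframe p u"
proof -
  obtain c where c: "c \<in> A" "p \<in> cdom c" using chart_at by blast
  obtain d where d: "d \<in> A" "mul a p \<in> cdom d" using chart_at by blast
  have *: "mul (inve (mul a p)) a = inve p"
    by (simp add: inverse_distrib_swap assoc)
  have "mul (inve p) p \<in> cdom c0" using c0 by simp
  then have "mul (inve (mul a p)) (mul a p) \<in> cdom c0" by simp
  then show ?thesis
    using coframe_eq[OF differential_tangent[OF assms] d] coframe_eq[OF assms c]
      TD_chain[OF c(1) d(1) c0(1) c(2) d(2), of "inve (mul a p)" "u c"] d
    by (simp add: differential_eq[OF assms c] *)
qed

section \<open>Frame and coframe in coordinates\<close>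

definition Lc where "Lc c x v = frame v (cinv c x) c"
definition Wc where "Wc c x y = TD (inve (cinv c x)) c c0 (cinv c x) y"

lemma Lc_eq: "c \<in> A \<Longrightarrow> x \<in> crange c \<Longrightarrow> Lc c x v = TD (cinv c x) c0 c e v"
  unfolding Lc_def frame_def by simp

lemma Wc_linear: "c \<in> A \<Longrightarrow> x \<in> crange c \<Longrightarrow> linear (Wc c x)"
  unfolding Wc_def using TD_linear[of c c0 "cinv c x" "inve (cinv c x)"] c0 by simp

lemma Lc_linear: "c \<in> A \<Longrightarrow> x \<in> crange c \<Longrightarrow> linear (Lc c x)"
proof -
  assume "c \<in> A" "x \<in> crange c"
  then have "Lc c x = TD (cinv c x) c0 c e" by (intro ext) (rule Lc_eq)
  with TD_linear[of c0 c e "cinv c x"] \<open>c \<in> A\<close> \<open>x \<in> crange c\<close> show "linear (Lc c x)"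
    by (simp add: c0 right_neutral)
qed

lemma Wc_Lc: "c \<in> A \<Longrightarrow> x \<in> crange c \<Longrightarrow> Wc c x (Lc c x v) = v"
  using coframe_surj[of c "cinv c x" v] by (simp add: Wc_def Lc_eq)

lemma Lc_Wc: "c \<in> A \<Longrightarrow> x \<in> crange c \<Longrightarrow> Lc c x (Wc c x y) = y"
  using coframe_inj[of c "cinv c x" y] by (simp add: Wc_def Lc_eq)

text \<open>A left invariant field is the partial derivative of the multiplication in its second
  argument, restricted to the slice where that argument is e.\<close>

lemma Lc_smooth:
  assumes c: "c \<in> A"
  shows "smooth_on (crange c) (\<lambda>x. Lc c x v)"
proof -
  let ?Q = "\<lambda>z. frechet_derivative (mul_coord c c0 c) (at z) (0, v)"
  have Q: "smooth_on (mul_dom c c0 c) ?Q"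
    by (intro smooth_on_frechet_derivative smooth_mul_coord c c0)
  have mem: "(x, cmap c0 e) \<in> mul_dom c c0 c" if "x \<in> crange c" for x
    using that c c0 by (auto simp: mul_dom_def right_neutral)
  have "bounded_linear (\<lambda>x::real^'n. (x, 0::real^'n))"
    by (intro bounded_linear_Pair bounded_linear_ident bounded_linear_zero)
  then have "smooth_on (crange c) (\<lambda>x. (x, 0) + (0, cmap c0 e))"
    by (intro smooth_on_add chart_facts c smooth_on_const smooth_on_bounded_linear)
  then have "smooth_on (crange c) (\<lambda>x. ?Q (x, cmap c0 e))"
    by (intro smooth_on_compose[OF Q _ chart_facts(2)[OF c] open_mul_dom[OF c c0(1) c]])
      (use mem in simp_all)
  then show ?thesis
  proof (rule smooth_on_cong[OF _ chart_facts(2)[OF c]])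
    fix x assume x: "x \<in> crange c"
    show "?Q (x, cmap c0 e) = Lc c x v"
      using TD_eq_mul_coord[OF c c0(1) c, of "cinv c x" e v] x c c0
      by (simp add: Lc_eq right_neutral)
  qed
qed

text \<open>\<open>Wc c x y\<close> solves a linear system whose invertible matrix
  \<open>Lc c x\<close> depends smoothly on x.\<close>

lemma Wc_smooth:
  assumes c: "c \<in> A"
  shows "smooth_on (crange c) (\<lambda>x. Wc c x y)"
proof (rule smooth_on_linear_solution[OF chart_facts(2)[OF c] Lc_smooth[OF c] smooth_on_const])
  show "inj (Lc c x)" if "x \<in> crange c" for x using Wc_Lc[OF c that] by (metis injI)
qed (use Lc_linear Lc_Wc c in auto)

lemma frame_vector_field: "vector_field A (frame v)"
  unfolding vector_field_def using frame_tangent Lc_smooth unfolding Lc_def by blast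

lemma frame_in_lie_algebra: "frame v \<in> lie_algebra mul A"
proof -
  have "frame v (mul x p) = differential A A (mul x) p (frame v p)" for x p
    using frame_coframe[OF differential_tangent[OF frame_tangent]]
      coframe_differential[OF frame_tangent] by (simp add: coframe_frame)
  then show ?thesis using frame_vector_field by (auto simp: lie_algebra_def)
qed

lemma coframe_coord_tvec:
  assumes "c \<in> A" "x \<in> crange c"
  shows "coframe (cinv c x) (coord_tvec A c (cinv c x) y) = Wc c x y"
  using coframe_eq[OF coord_tvec_tangent, of c "cinv c x" c y] TD_id[of c "cinv c x" y] assms
  by (simp add: coord_tvec_eq Wc_def)

text \<open>By this invariance a potential of the coframe and its composite with a left translation
  have the same derivative.\<close>

lemma Wc_left_invariant:
  assumes "x \<in> crange c0" "y \<in> crange c0" "mul (cinv c0 x) (cinv c0 y) \<in> cdom c0"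
  shows "Wc c0 (mul_coord c0 c0 c0 (x, y)) (TD (cinv c0 x) c0 c0 (cinv c0 y) v) = Wc c0 y v"
proof -
  let ?a = "cinv c0 x" and ?p = "cinv c0 y"
  have *: "mul (inve (mul ?a ?p)) ?a = inve ?p" by (simp add: inverse_distrib_swap assoc)
  have "mul (inve (mul ?a ?p)) (mul ?a ?p) \<in> cdom c0" using c0 by simp
  then show ?thesis
    using TD_chain[of c0 c0 c0 ?p ?a "inve (mul ?a ?p)" v] assms c0
    by (simp add: Wc_def mul_coord_def *)
qed

text \<open>A closed coframe is locally \<open>d\<phi>\<close>. By left invariance \<open>\<phi>\<close> is, up to a constant, a local
  homomorphism into an abelian group, and it is locally injective.\<close>

lemma closed_coframe_imp_locally_commutative:
  assumes closed: "\<And>x y z. x \<in> crange c0 \<Longrightarrow>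
    frechet_derivative (\<lambda>x. Wc c0 x z) (at x) y = frechet_derivative (\<lambda>x. Wc c0 x y) (at x) z"
  shows "\<exists>N. open N \<and> e \<in> N \<and> (\<forall>p\<in>N. \<forall>q\<in>N. mul p q = mul q p)"
proof -
  define x0 where "x0 = cmap c0 e"
  let ?S = "crange c0" and ?m = "\<lambda>x y. mul_coord c0 c0 c0 (x, y)"
  have S: "open ?S" "x0 \<in> ?S" using chart_facts(2) c0 by (auto simp: x0_def)
  then obtain r where r: "r > 0" "ball x0 r \<subseteq> ?S" using open_contains_ball by blast
  have sm: "smooth_on (ball x0 r) (\<lambda>x. Wc c0 x y)" for y
    using smooth_on_subset[OF Wc_smooth[OF c0(1)] r(2)] .
  have "\<exists>\<phi>. \<forall>x\<in>ball x0 r. (\<phi> has_derivative Wc c0 x) (at x)"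
  proof (rule closed_one_form_exact[OF open_ball convex_ball _ sm])
    show "linear (Wc c0 x)" if "x \<in> ball x0 r" for x
      using Wc_linear[OF c0(1)] r(2) that by blast
    show "frechet_derivative (\<lambda>x. Wc c0 x z) (at x) y = frechet_derivative (\<lambda>x. Wc c0 x y) (at x) z"
      if "x \<in> ball x0 r" for x y z
      using closed r(2) that by blast
  qed
  then obtain \<phi> where \<phi>: "\<And>x. x \<in> ball x0 r \<Longrightarrow> (\<phi> has_derivative Wc c0 x) (at x)" by blast
  obtain r1 where r1: "r1 > 0" "ball x0 r1 \<subseteq> ball x0 r" "inj_on \<phi> (ball x0 r1)"
  proof (rule has_derivative_locally_injective[of x0 "ball x0 r" "Lc c0 x0" "Wc c0" \<phi>])
    show "bounded_linear (Lc c0 x0)" using Lc_linear[OF c0(1) S(2)] linear_conv_bounded_linear by blast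
    show "Lc c0 x0 \<circ> Wc c0 x0 = id" using Lc_Wc[OF c0(1) S(2)] by auto
    fix d :: real assume d: "d > 0"
    \<comment> \<open>Continuity is known for each fixed vector, whereas the local injectivity
      theorem asks for closeness in operator norm; in finite dimension the componentwise criterion
      suffices.\<close>
    let ?B = "\<lambda>x. Blinfun (Wc c0 x)"
    have B: "blinfun_apply (?B x) = Wc c0 x" if "x \<in> ball x0 r" for x
      using Wc_linear[OF c0(1)] that r(2) linear_conv_bounded_linear bounded_linear_Blinfun_apply by blast
    have "continuous_on (ball x0 r) ?B"
    proof (rule continuous_on_blinfun_componentwise)
      show "continuous_on (ball x0 r) (\<lambda>x. ?B x i)" for i
        by (rule continuous_on_eq[OF smooth_on_continuous_on[OF sm, of i]]) (simp only: B)
    qed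
    then have "\<exists>s>0. \<forall>x\<in>ball x0 r. dist x x0 < s \<longrightarrow> dist (?B x) (?B x0) < d"
      unfolding continuous_on_iff using r(1) d centre_in_ball by blast
    then obtain s where s: "s > 0" "\<And>x. x \<in> ball x0 r \<Longrightarrow> dist x x0 < s \<Longrightarrow> dist (?B x) (?B x0) < d"
      by blast
    have "onorm (\<lambda>v. Wc c0 x v - Wc c0 x0 v) < d" if "dist x0 x < min r s" for x
    proof -
      have x: "x \<in> ball x0 r" using that by simp
      have "dist (?B x) (?B x0) = onorm (\<lambda>v. Wc c0 x v - Wc c0 x0 v)"
        using B[OF x] B[of x0] r(1) unfolding dist_norm norm_blinfun.rep_eq by (simp add: minus_blinfun.rep_eq)
      then show ?thesis using s(2)[OF x] that by (simp add: dist_commute)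
    qed
    then show "\<exists>s>0. \<forall>x. dist x0 x < s \<longrightarrow> onorm (\<lambda>v. Wc c0 x v - Wc c0 x0 v) < d"
      using r(1) s(1) by (intro exI[of _ "min r s"]) auto
  qed (use r \<phi> in auto)
  have m0: "(x0, x0) \<in> mul_dom c0 c0 c0" "?m x0 x0 = x0"
    using c0 S(2) by (simp_all add: mul_dom_def mul_coord_def x0_def right_neutral)
  have "open (mul_dom c0 c0 c0 \<inter> mul_coord c0 c0 c0 -` ball x0 r1)"
    by (rule continuous_open_preimage[OF smooth_on_continuous_on[OF smooth_mul_coord] open_mul_dom])
      (use c0 in auto)
  moreover have "(x0, x0) \<in> mul_dom c0 c0 c0 \<inter> mul_coord c0 c0 c0 -` ball x0 r1"
    using m0 r1(1) by simp
  \<comment> \<open>Products of points near \<open>x0\<close> stay in \<open>ball x0 r1\<close>,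
    where \<open>\<phi>\<close> is injective.\<close>
  ultimately obtain P Q where PQ: "open P" "open Q" "x0 \<in> P" "x0 \<in> Q"
    "P \<times> Q \<subseteq> mul_dom c0 c0 c0 \<inter> mul_coord c0 c0 c0 -` ball x0 r1"
    by (auto elim!: open_prod_elim)
  have "open (P \<inter> Q \<inter> ball x0 r)" "x0 \<in> P \<inter> Q \<inter> ball x0 r" using PQ r by auto
  then obtain r2 where r2: "r2 > 0" "ball x0 r2 \<subseteq> P \<inter> Q \<inter> ball x0 r" using open_contains_ball by blast
  have m: "?m x y \<in> ball x0 r1" "(x, y) \<in> mul_dom c0 c0 c0" if "x \<in> ball x0 r2" "y \<in> ball x0 r2" for x y
  proof -
    have "(x, y) \<in> P \<times> Q" using that r2(2) by blast
    then show "?m x y \<in> ball x0 r1" "(x, y) \<in> mul_dom c0 c0 c0" using PQ(5) by blast+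
  qed
  have hom: "\<phi> (?m x y) = \<phi> x + \<phi> y - \<phi> x0" if x: "x \<in> ball x0 r2" and y: "y \<in> ball x0 r2" for x y
  proof -
    \<comment> \<open>With x fixed this difference is constant in y; evaluating it at
      \<open>x0\<close>, the coordinates of e, gives the homomorphism law up to the constant
      \<open>\<phi> x0\<close>.\<close>
    have "((\<lambda>y. \<phi> (?m x y) - \<phi> y) has_derivative (\<lambda>h. 0)) (at z within ball x0 r2)"
      if z: "z \<in> ball x0 r2" for z
    proof -
      note mem = m(2)[OF x z, unfolded mul_dom_def, simplified]
      have "((\<lambda>y. ?m x y) has_derivative TD (cinv c0 x) c0 c0 (cinv c0 z)) (at z)"
        using translation_has_derivative[OF c0(1) c0(1), of "cinv c0 z" "cinv c0 x"] mem c0(1)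
        by (simp add: mul_coord_def)
      moreover have "(\<phi> has_derivative Wc c0 (?m x z)) (at (?m x z))"
        using \<phi> m(1)[OF x z] r1(2) by blast
      ultimately have "((\<lambda>y. \<phi> (?m x y)) has_derivative
          (\<lambda>h. Wc c0 (?m x z) (TD (cinv c0 x) c0 c0 (cinv c0 z) h))) (at z)"
        by (rule has_derivative_compose)
      then have "((\<lambda>y. \<phi> (?m x y)) has_derivative Wc c0 z) (at z)"
        using Wc_left_invariant[of x z] mem by simp
      moreover have "(\<phi> has_derivative Wc c0 z) (at z)" using \<phi> z r2(2) by blast
      ultimately have "((\<lambda>y. \<phi> (?m x y) - \<phi> y) has_derivative (\<lambda>h. Wc c0 z h - Wc c0 z h)) (at z)"
        by (rule has_derivative_diff)
      then show ?thesis by (simp add: has_derivative_at_withinI)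
    qed
    from has_derivative_zero_unique[OF convex_ball this y, of x0]
    have "\<phi> (?m x y) - \<phi> y = \<phi> (?m x x0) - \<phi> x0" using r2(1) by simp
    moreover have "x \<in> ?S" using x r2(2) r(2) by blast
    then have "?m x x0 = x" using c0 by (simp add: mul_coord_def x0_def right_neutral)
    ultimately show ?thesis by (simp add: algebra_simps)
  qed
  have comm: "mul (cinv c0 x) (cinv c0 y) = mul (cinv c0 y) (cinv c0 x)"
    if "x \<in> ball x0 r2" "y \<in> ball x0 r2" for x y
  proof -
    have "\<phi> (?m x y) = \<phi> (?m y x)" using hom that by simp
    then have "?m x y = ?m y x" using r1(3) m(1) that by (metis inj_onD)
    then have "cinv c0 (?m x y) = cinv c0 (?m y x)" by simp
    then show ?thesis using m(2)[OF that] m(2)[OF that(2,1)] c0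
      by (simp add: mul_coord_def mul_dom_def)
  qed
  define N where "N = cdom c0 \<inter> cmap c0 -` ball x0 r2"
  have "open N"
    unfolding N_def by (intro continuous_open_preimage chart_facts c0 open_ball)
  moreover have "e \<in> N" using c0 r2(1) by (simp add: N_def x0_def)
  moreover have "mul p q = mul q p" if "p \<in> N" "q \<in> N" for p q
    using comm[of "cmap c0 p" "cmap c0 q"] that c0(1) by (simp add: N_def)
  ultimately show ?thesis by blast
qed

text \<open>The centralizer of \<open>T\<close> is a subgroup containing a neighbourhood of \<open>e\<close>, hence open and closed.\<close>

lemma component_subset_centralizer:
  assumes N: "open N" "e \<in> N" "\<And>p t. p \<in> N \<Longrightarrow> t \<in> T \<Longrightarrow> mul p t = mul t p"
    and p: "p \<in> connected_component_set UNIV e" and t: "t \<in> T"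
  shows "mul p t = mul t p"
proof -
  define H where "H = {p. \<forall>t\<in>T. mul p t = mul t p}"
  have H_mul: "mul p q \<in> H" if "p \<in> H" "q \<in> H" for p q
    using that unfolding H_def by (simp add: assoc) (metis assoc)
  have H_inv: "inve p \<in> H" if "p \<in> H" for p
  proof -
    have "mul (inve p) t = mul t (inve p)" if "t \<in> T" for t
    proof -
      have "mul p (mul (inve p) t) = mul p (mul t (inve p))"
        using \<open>p \<in> H\<close> that unfolding H_def by (simp flip: assoc) (simp add: assoc)
      then show ?thesis by (simp add: left_cancel)
    qed
    then show ?thesis unfolding H_def by simp
  qed
  have NH: "N \<subseteq> H" using N(3) unfolding H_def by blast
  have op: "open {q. mul (inve p) q \<in> N}" and mem: "p \<in> {q. mul (inve p) q \<in> N}" for p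
    using continuous_open_preimage[OF continuous_mul[OF continuous_on_const continuous_on_id] open_UNIV N(1), of "inve p"]
      N(2) by (simp_all add: vimage_def)
  have "open H"
  proof (subst open_subopen, intro ballI)
    fix p assume p: "p \<in> H"
    have "q \<in> H" if "mul (inve p) q \<in> N" for q
      using H_mul[OF p, of "mul (inve p) q"] NH that by (auto simp flip: assoc)
    with op[of p] mem[of p] show "\<exists>T. open T \<and> p \<in> T \<and> T \<subseteq> H" by blast
  qed
  moreover have "open (- H)"
  proof (subst open_subopen, intro ballI)
    fix p assume p: "p \<in> - H"
    have "q \<in> - H" if q: "mul (inve p) q \<in> N" for q
    proof
      assume "q \<in> H"
      then have "mul q (inve (mul (inve p) q)) \<in> H" using H_mul H_inv NH q by blast
      also have "mul q (inve (mul (inve p) q)) = p" by (simp add: inverse_distrib_swap flip: assoc)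
      finally show False using p by simp
    qed
    with op[of p] mem[of p] show "\<exists>T. open T \<and> p \<in> T \<and> T \<subseteq> - H" by blast
  qed
  ultimately have "connected_component_set UNIV e \<subseteq> H"
    using connectedD[OF connected_connected_component, of H "- H" UNIV e] N(2) NH
      connected_component_refl[of e UNIV] by blast
  then show ?thesis using p t unfolding H_def by blast
qed

text \<open>The centralizer argument is used twice: it shows that the component centralizes
  \<open>N\<close>, hence that \<open>N\<close> centralizes the component, and then that the
  component centralizes itself.\<close>

lemma closed_coframe_imp_component_commutative:
  assumes "\<And>x y z. x \<in> crange c0 \<Longrightarrow>
    frechet_derivative (\<lambda>x. Wc c0 x z) (at x) y = frechet_derivative (\<lambda>x. Wc c0 x y) (at x) z"
    and "p \<in> connected_component_set UNIV e" "q \<in> connected_component_set UNIV e"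
  shows "mul p q = mul q p"
proof -
  obtain N where N: "open N" "e \<in> N" "\<forall>p\<in>N. \<forall>q\<in>N. mul p q = mul q p"
    using closed_coframe_imp_locally_commutative[OF assms(1)] by blast
  have "mul p t = mul t p" if "p \<in> connected_component_set UNIV e" "t \<in> N" for p t
    using component_subset_centralizer[OF N(1,2), of N] N(3) that by blast
  then show ?thesis
    using component_subset_centralizer[OF N(1,2), of "connected_component_set UNIV e"] assms(2,3) by metis
qed

text \<open>\<open>differential\<close> reads its argument in one chosen chart only, so this
  formula, and with it linearity of \<open>coframe\<close>, holds for arbitrary families of
  components and not just for tangent vectors.\<close>

lemma coframe_some_chart:
  "\<exists>c\<in>A. p \<in> cdom c \<and> (\<forall>u. coframe p u = TD (inve p) c c0 p (u c))"
proof -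
  define c where "c = (SOME c. c \<in> A \<and> p \<in> cdom c)"
  have "c \<in> A" "p \<in> cdom c" using someI_ex[OF chart_at, of p] unfolding c_def by auto
  moreover have "coframe p u = TD (inve p) c c0 p (u c)" for u
    using c0 unfolding coframe_def differential_def c_def[symmetric] Let_def TD_def o_def by simp
  ultimately show ?thesis by blast
qed

lemma coframe_combination:
  "coframe p (\<lambda>c. a *\<^sub>R u c + b *\<^sub>R v c) = a *\<^sub>R coframe p u + b *\<^sub>R coframe p v"
proof -
  obtain c where c: "c \<in> A" "p \<in> cdom c" "\<And>u. coframe p u = TD (inve p) c c0 p (u c)"
    using coframe_some_chart by blast
  have "linear (TD (inve p) c c0 p)" using TD_linear[of c c0 p "inve p"] c c0 by simp
  then show ?thesis unfolding c(3) by (simp add: linear_add linear_cmul)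
qed

lemma coframe_nonzero:
  assumes "u \<in> tangent_space A p" "u \<noteq> (\<lambda>c. 0)"
  shows "coframe p u \<noteq> 0"
proof
  assume "coframe p u = 0"
  moreover have "frame 0 p = (\<lambda>c. 0)"
  proof
    fix d
    have "linear (TD p c0 d e)" if "d \<in> A" "p \<in> cdom d"
      using TD_linear[of c0 d e p] that c0 by (simp add: right_neutral)
    then show "frame 0 p d = 0" by (auto simp: frame_def linear_0)
  qed
  ultimately show False using frame_coframe[OF assms(1)] assms(2) by simp
qed

section \<open>Metrics pulled back along the coframe\<close>

definition left_inner where "left_inner p u w = coframe p u \<bullet> coframe p w"

definition left_randers where "left_randers \<xi> p u = randers_norm \<xi> (coframe p u)"

lemma local_rep_left_randers:
  "c \<in> A \<Longrightarrow> x \<in> crange c \<Longrightarrow> local_rep A c (left_randers \<xi>) x y = randers_norm \<xi> (Wc c x y)"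
  unfolding local_rep_def left_randers_def by (simp only: coframe_coord_tvec)

lemma left_invariant_riemannian_left_inner: "left_invariant_riemannian mul A left_inner"
  unfolding left_invariant_riemannian_def riemannian_metric_def
proof (intro conjI allI ballI impI)
  fix p u v w and a b :: real
  show "left_inner p u v = left_inner p v u" by (simp add: left_inner_def inner_commute)
  show "left_inner p (\<lambda>c. a *\<^sub>R u c + b *\<^sub>R v c) w = a * left_inner p u w + b * left_inner p v w"
    by (simp add: left_inner_def coframe_combination inner_add_left)
next
  fix p u assume "u \<in> tangent_space A p" "u \<noteq> (\<lambda>c. 0)"
  then show "0 < left_inner p u u" using coframe_nonzero by (simp add: left_inner_def)
next
  fix c u v assume c: "c \<in> A"
  have "smooth_on (crange c) (\<lambda>x. Wc c x u \<bullet> Wc c x v)"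
    by (intro smooth_on_inner chart_facts Wc_smooth c)
  then show "smooth_on (crange c)
      (\<lambda>x. left_inner (cinv c x) (coord_tvec A c (cinv c x) u) (coord_tvec A c (cinv c x) v))"
    by (rule smooth_on_cong[OF _ chart_facts(2)[OF c]])
      (simp only: left_inner_def coframe_coord_tvec[OF c])
next
  fix x p u v assume "u \<in> tangent_space A p" "v \<in> tangent_space A p"
  then show "left_inner (mul x p) (differential A A (mul x) p u) (differential A A (mul x) p v) =
      left_inner p u v"
    by (simp only: left_inner_def coframe_differential)
qed

end

section \<open>The bracket and the Randers metric\<close>

locale bracket_span_lie_group = vec_lie_group mul e inve A
  for mul :: "'g::{t2_space, second_countable_topology} \<Rightarrow> 'g \<Rightarrow> 'g" and e :: 'g
    and inve :: "'g \<Rightarrow> 'g" and A :: "('g, real^'n) chart set" +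
  assumes bracket_span: "\<And>X Y. X \<in> lie_algebra mul A \<Longrightarrow> Y \<in> lie_algebra mul A \<Longrightarrow>
    \<exists>a b :: real. lie_bracket A X Y = (\<lambda>p c. a *\<^sub>R X p c + b *\<^sub>R Y p c)"
begin

text \<open>By \<open>bracket_span\<close> the bracket of \<open>frame v\<close> and \<open>frame w\<close> is a combination of them with constant
  coefficients, hence the left invariant field with value \<open>br v w\<close> at \<open>e\<close>.\<close>

definition br where "br v w = lie_bracket A (frame v) (frame w) e c0"

lemma frame_e: "frame v e c0 = v"
  using TD_id[OF c0, of v] c0 by (simp add: frame_def)

lemma br_span: "\<exists>a b. br v w = a *\<^sub>R v + b *\<^sub>R w"
proof -
  obtain a b where ab: "lie_bracket A (frame v) (frame w) = (\<lambda>p c. a *\<^sub>R frame v p c + b *\<^sub>R frame w p c)"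
    using bracket_span[OF frame_in_lie_algebra frame_in_lie_algebra] by blast
  show ?thesis using fun_cong[OF fun_cong[OF ab], of e c0]
    by (auto simp: br_def frame_e)
qed

lemma lie_bracket_frame:
  assumes "c \<in> A" "x \<in> crange c"
  shows "frechet_derivative (\<lambda>x. Lc c x w) (at x) (Lc c x v) -
    frechet_derivative (\<lambda>x. Lc c x v) (at x) (Lc c x w) = Lc c x (br v w)"
proof -
  obtain a b where ab: "lie_bracket A (frame v) (frame w) = (\<lambda>p c. a *\<^sub>R frame v p c + b *\<^sub>R frame w p c)"
    using bracket_span[OF frame_in_lie_algebra frame_in_lie_algebra] by blast
  have "br v w = a *\<^sub>R v + b *\<^sub>R w"
    using fun_cong[OF fun_cong[OF ab], of e c0] by (simp add: br_def frame_e)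
  moreover have "lie_bracket A (frame v) (frame w) (cinv c x) c = a *\<^sub>R Lc c x v + b *\<^sub>R Lc c x w"
    unfolding ab Lc_def ..
  ultimately show ?thesis
    using assms by (simp add: lie_bracket_def Lc_def[symmetric]
        linear_add[OF Lc_linear[OF assms]] linear_cmul[OF Lc_linear[OF assms]])
qed

lemma br_eq:
  "br v w = frechet_derivative (\<lambda>x. Lc c0 x w) (at (cmap c0 e)) v -
    frechet_derivative (\<lambda>x. Lc c0 x v) (at (cmap c0 e)) w"
  using c0 by (simp add: br_def lie_bracket_def Lc_def frame_e)

lemma br_antisym: "br v w = - br w v"
  by (simp add: br_eq)

lemma br_linear_right: "linear (br v)"
proof -
  have x: "cmap c0 e \<in> crange c0" using c0 by simp
  note D = smooth_on_has_derivative[OF Lc_smooth[OF c0(1)] x]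
  have "linear (\<lambda>w. frechet_derivative (\<lambda>x. Lc c0 x w) (at (cmap c0 e)) v)"
    by (rule linear_frechet_derivative_family[OF chart_facts(2)[OF c0(1)] x Lc_linear[OF c0(1)]])
      (use D differentiableI in blast)+
  moreover have "linear (frechet_derivative (\<lambda>x. Lc c0 x v) (at (cmap c0 e)))"
    using D has_derivative_linear by blast
  ultimately show ?thesis unfolding br_eq by (rule linear_compose_sub)
qed

lemma br_linear_left: "linear (\<lambda>v. br v w)"
proof -
  have "(\<lambda>v. br v w) = (\<lambda>v. - br w v)" using br_antisym by blast
  then show ?thesis using linear_compose_neg[OF br_linear_right] by simp
qed

lemma br_milnor: "\<exists>\<mu>. \<forall>v w. br v w = (\<mu> \<bullet> v) *\<^sub>R w - (\<mu> \<bullet> w) *\<^sub>R v"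
  by (rule antisymmetric_bilinear_in_span[OF br_linear_left br_linear_right br_antisym br_span])

text \<open>The Maurer-Cartan equation. Since the coframe takes constant values on the frame, its
  derivative is minus the coframe applied to the derivative of the frame; antisymmetrising produces
  the bracket of left invariant fields.\<close>

lemma Wc_structure:
  assumes c: "c \<in> A" and x: "x \<in> crange c"
  shows "frechet_derivative (\<lambda>x. Wc c x z) (at x) y - frechet_derivative (\<lambda>x. Wc c x y) (at x) z =
    - br (Wc c x y) (Wc c x z)"
proof -
  note S = chart_facts(2)[OF c]
  have key: "frechet_derivative (\<lambda>z. Wc c z (Lc c x w)) (at x) k =
      - Wc c x (frechet_derivative (\<lambda>x. Lc c x w) (at x) k)" for w k
  proof -
    have "((\<lambda>z. Wc c z (Lc c z w)) has_derivative
        (\<lambda>k. frechet_derivative (\<lambda>z. Wc c z (Lc c x w)) (at x) k +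
          Wc c x (frechet_derivative (\<lambda>z. Lc c z w) (at x) k))) (at x)"
    proof (rule has_derivative_linear_family[OF S x Wc_linear[OF c], where u = "\<lambda>z. Lc c z w" and
          W' = "\<lambda>k b. frechet_derivative (\<lambda>z. Wc c z b) (at x) k"])
      show "((\<lambda>z. Wc c z b) has_derivative (\<lambda>k. frechet_derivative (\<lambda>z. Wc c z b) (at x) k)) (at x)" for b
        by (rule smooth_on_has_derivative[OF Wc_smooth[OF c] x])
      show "((\<lambda>z. Lc c z w) has_derivative (\<lambda>k. frechet_derivative (\<lambda>z. Lc c z w) (at x) k)) (at x)"
        by (rule smooth_on_has_derivative[OF Lc_smooth[OF c] x])
    qed
    moreover have "((\<lambda>z. Wc c z (Lc c z w)) has_derivative (\<lambda>k. 0)) (at x)"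
      by (rule has_derivative_transform_within_open[OF has_derivative_const S x]) (simp add: Wc_Lc c)
    ultimately have "frechet_derivative (\<lambda>z. Wc c z (Lc c x w)) (at x) k +
          Wc c x (frechet_derivative (\<lambda>z. Lc c z w) (at x) k) = 0"
      by (rule fun_cong[OF has_derivative_unique])
    then show ?thesis by (simp only: eq_neg_iff_add_eq_0)
  qed
  define v where "v = Wc c x y"
  define w where "w = Wc c x z"
  have y: "y = Lc c x v" and z: "z = Lc c x w" using Lc_Wc[OF c x] by (simp_all add: v_def w_def)
  have "frechet_derivative (\<lambda>x. Wc c x z) (at x) y - frechet_derivative (\<lambda>x. Wc c x y) (at x) z =
      - (Wc c x (frechet_derivative (\<lambda>x. Lc c x w) (at x) (Lc c x v)) -
         Wc c x (frechet_derivative (\<lambda>x. Lc c x v) (at x) (Lc c x w)))"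
    unfolding y z key by simp
  also have "\<dots> = - br v w"
    using lie_bracket_frame[OF c x, of w v] by (simp add: Wc_Lc[OF c x] flip: linear_diff[OF Wc_linear[OF c x]])
  finally show ?thesis by (simp add: v_def w_def)
qed

lemma local_randers_left_randers:
  assumes "c \<in> A" "0 < k" "norm (k *\<^sub>R \<mu>) < 1"
    and br: "\<And>v w. br v w = (\<mu> \<bullet> v) *\<^sub>R w - (\<mu> \<bullet> w) *\<^sub>R v"
  shows "local_randers (crange c) (Wc c) (Lc c) k \<mu> (local_rep A c (left_randers (k *\<^sub>R \<mu>)))"
proof (rule local_randers.intro)
  fix x y z assume x: "x \<in> crange c"
  show "frechet_derivative (\<lambda>x. Wc c x z) (at x) y - frechet_derivative (\<lambda>x. Wc c x y) (at x) z =
      (\<mu> \<bullet> Wc c x z) *\<^sub>R Wc c x y - (\<mu> \<bullet> Wc c x y) *\<^sub>R Wc c x z"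
    unfolding Wc_structure[OF assms(1) x] br by simp
qed (use assms in \<open>simp_all only: chart_facts Wc_linear Wc_Lc Lc_Wc Wc_smooth local_rep_left_randers\<close>)

lemma left_invariant_finsler_left_randers:
  assumes "0 < k" "norm (k *\<^sub>R \<mu>) < 1"
    and br: "\<And>v w. br v w = (\<mu> \<bullet> v) *\<^sub>R w - (\<mu> \<bullet> w) *\<^sub>R v"
  shows "left_invariant_finsler mul e inve A (left_randers (k *\<^sub>R \<mu>))"
  unfolding left_invariant_finsler_def finsler_metric_def
proof (intro conjI allI ballI impI)
  fix p v
  show "0 \<le> left_randers (k *\<^sub>R \<mu>) p v"
    using randers_norm_pos[OF assms(2), of "coframe p v"]
    by (cases "coframe p v = 0") (simp_all add: left_randers_def less_imp_le, simp add: randers_norm_def)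
  fix t :: real assume "0 < t"
  then show "left_randers (k *\<^sub>R \<mu>) p (\<lambda>c. t *\<^sub>R v c) = t * left_randers (k *\<^sub>R \<mu>) p v"
    using coframe_combination[of p t v 0 v] randers_norm_scaleR[of t "k *\<^sub>R \<mu>" "coframe p v"]
    by (simp add: left_randers_def)
next
  fix c assume "c \<in> A"
  then show "smooth_on (crange c \<times> - {0}) (\<lambda>(x, y). local_rep A c (left_randers (k *\<^sub>R \<mu>)) x y)"
    by (rule local_randers.f_smooth[OF local_randers_left_randers[OF _ assms]])
next
  fix c and x y w :: "real^'n" assume "c \<in> A" "x \<in> crange c" "y \<noteq> 0" "w \<noteq> 0"
  then show "0 < w \<bullet> (fundamental_tensor (local_rep A c (left_randers (k *\<^sub>R \<mu>))) x y *v w)"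
    by (intro local_randers.fundamental_tensor_pos[OF local_randers_left_randers[OF _ assms]])
next
  fix x y assume "y \<in> tangent_space A x"
  then show "left_randers (k *\<^sub>R \<mu>) x y =
      left_randers (k *\<^sub>R \<mu>) e (differential A A (mul (inve x)) x y)"
    using coframe_differential[of y x "inve x"] by (simp add: left_randers_def)
qed

lemma left_invariant_randers_left_randers:
  assumes "0 < k" "norm (k *\<^sub>R \<mu>) < 1"
    and br: "\<And>v w. br v w = (\<mu> \<bullet> v) *\<^sub>R w - (\<mu> \<bullet> w) *\<^sub>R v"
  shows "left_invariant_randers mul e inve A (left_randers (k *\<^sub>R \<mu>))"
  unfolding left_invariant_randers_def
proof (intro conjI exI allI ballI)
  show "left_invariant_finsler mul e inve A (left_randers (k *\<^sub>R \<mu>))"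
    by (rule left_invariant_finsler_left_randers[OF assms])
  show "left_invariant_riemannian mul A left_inner" by (rule left_invariant_riemannian_left_inner)
  show "frame (k *\<^sub>R \<mu>) \<in> lie_algebra mul A" by (rule frame_in_lie_algebra)
  fix x y
  show "sqrt (left_inner x (frame (k *\<^sub>R \<mu>) x) (frame (k *\<^sub>R \<mu>) x)) < 1"
    unfolding left_inner_def coframe_frame using assms(2) by (simp only: norm_eq_sqrt_inner)
  show "left_randers (k *\<^sub>R \<mu>) x y = sqrt (left_inner x y y) + left_inner x (frame (k *\<^sub>R \<mu>) x) y"
    unfolding left_inner_def coframe_frame left_randers_def randers_norm_def
    by (simp only: norm_eq_sqrt_inner)
qed

lemma douglas_type_left_randers:
  assumes "0 < k" "norm (k *\<^sub>R \<mu>) < 1"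
    and br: "\<And>v w. br v w = (\<mu> \<bullet> v) *\<^sub>R w - (\<mu> \<bullet> w) *\<^sub>R v"
  shows "douglas_type A (left_randers (k *\<^sub>R \<mu>))"
  unfolding douglas_type_def
proof (intro ballI exI conjI allI impI)
  fix c x y assume c: "c \<in> A" and x: "x \<in> crange c" and y: "y \<noteq> (0::real^'n)"
  interpret loc: local_randers "crange c" "Wc c" "Lc c" k \<mu> "local_rep A c (left_randers (k *\<^sub>R \<mu>))"
    by (rule local_randers_left_randers[OF c assms])
  {
    fix t :: real assume "0 < t"
    then show "randers_spray_factor k \<mu> (Wc c x (t *\<^sub>R y)) = t * randers_spray_factor k \<mu> (Wc c x y)"
      using loc.spray_factor_homogeneous x by blast
  next
    fix i
    show "spray_coeff (local_rep A c (left_randers (k *\<^sub>R \<mu>))) i x y =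
        1/2 * (\<Sum>j\<in>UNIV. \<Sum>k\<in>UNIV. loc.spray_quadratic x (axis j 1) (axis k 1) $ i * y $ j * y $ k) +
        randers_spray_factor k \<mu> (Wc c x y) * y $ i"
      using loc.spray_coeff_douglas x y by blast
  }
qed

lemma not_berwald_type_left_randers:
  assumes "0 < k" "norm (k *\<^sub>R \<mu>) < 1"
    and br: "\<And>v w. br v w = (\<mu> \<bullet> v) *\<^sub>R w - (\<mu> \<bullet> w) *\<^sub>R v"
    and nonzero: "br v w \<noteq> 0"
  shows "\<not> berwald_type A (left_randers (k *\<^sub>R \<mu>))"
proof
  assume berwald: "berwald_type A (left_randers (k *\<^sub>R \<mu>))"
  define x where "x = cmap c0 e"
  have x: "x \<in> crange c0" using c0 by (simp add: x_def)
  interpret loc: local_randers "crange c0" "Wc c0" "Lc c0" k \<mu> "local_rep A c0 (left_randers (k *\<^sub>R \<mu>))"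
    by (rule local_randers_left_randers[OF c0(1) assms(1-3)])
  \<comment> \<open>\<open>\<mu>\<close> is orthogonal to every bracket, so a nonzero bracket value
    is itself the required vector orthogonal to \<open>\<mu>\<close>.\<close>
  let ?y = "Lc c0 x (br v w)"
  have W: "Wc c0 x ?y = br v w" by (rule Wc_Lc[OF c0(1) x])
  then have y: "?y \<noteq> 0" using nonzero linear_0[OF Wc_linear[OF c0(1) x]] by metis
  have "\<mu> \<bullet> Wc c0 x ?y = 0" unfolding W by (simp add: br inner_diff_right mult.commute)
  moreover have "\<mu> \<noteq> 0" using nonzero br by auto
  ultimately have "\<exists>i j l. chern_christoffel (local_rep A c0 (left_randers (k *\<^sub>R \<mu>))) i j l x ?y \<noteq>
      chern_christoffel (local_rep A c0 (left_randers (k *\<^sub>R \<mu>))) i j l x (- ?y)"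
    by (rule loc.chern_christoffel_not_constant[OF x y])
  moreover have "- ?y \<noteq> 0" using y by simp
  ultimately show False using berwald c0(1) x y unfolding berwald_type_def by blast
qed

end

theorem corollary4p4:
  fixes mul :: "'g::{t2_space, second_countable_topology} \<Rightarrow> 'g \<Rightarrow> 'g"
    and e :: 'g and inve :: "'g \<Rightarrow> 'g"
    and A :: "('g, real^'n) chart set"
  assumes "family_G1 mul e inve A"
  shows "\<exists>F. left_invariant_randers mul e inve A F \<and> douglas_type A F \<and> \<not> berwald_type A F"
proof -
  interpret lie_group mul e inve A using assms unfolding family_G1_def by blast
  interpret bracket_span_lie_group mul e inve A
    by unfold_locales (use assms in \<open>unfold family_G1_def, blast\<close>)
  obtain \<mu> where \<mu>: "\<And>v w. br v w = (\<mu> \<bullet> v) *\<^sub>R w - (\<mu> \<bullet> w) *\<^sub>R v"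
    using br_milnor by blast
  have "\<exists>v w. br v w \<noteq> 0"
  proof (rule ccontr)
    assume "\<not> ?thesis"
    then have "frechet_derivative (\<lambda>x. Wc c0 x z) (at x) y = frechet_derivative (\<lambda>x. Wc c0 x y) (at x) z"
      if "x \<in> crange c0" for x y z
      using Wc_structure[OF c0(1) that, of z y] by simp
    then have "mul p q = mul q p"
      if "p \<in> connected_component_set UNIV e" "q \<in> connected_component_set UNIV e" for p q
      using closed_coframe_imp_component_commutative that by blast
    then show False using assms unfolding family_G1_def by blast
  qed
  then obtain v w where vw: "br v w \<noteq> 0" by blast
  then have "\<mu> \<noteq> 0" using \<mu> by auto
  \<comment> \<open>With this choice k \<mu> has norm 1/2; any positive k below 1 / |\<mu>| would
    serve.\<close>
  define k where "k = 1 / (2 * norm \<mu>)"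
  have k: "0 < k" "norm (k *\<^sub>R \<mu>) < 1" using \<open>\<mu> \<noteq> 0\<close> by (simp_all add: k_def)
  show ?thesis
    using left_invariant_randers_left_randers[OF k \<mu>] douglas_type_left_randers[OF k \<mu>]
      not_berwald_type_left_randers[OF k \<mu> vw] by blast
qed

end
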